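(* Let $H$ be a cocommutative Hopf algebra. Set $X:=H\otimes H$, with the comultiplication $\Delta_X(x\otimes y)=(x^{(1)}\otimes y^{(1)})\otimes(x^{(2)}\otimes y^{(2)})$, define $\nu:X\to H$ by $\nu(x\otimes y):=xy$, and define the right action of $H$ on $X$ by $(x\otimes y)\cdot g:=ad_{g^{(1)}}(x)\otimes ad_{g^{(2)}}(y)$, where $ad_g(x)=S(g^{(1)})\,x\,g^{(2)}$. Then the R-matrix associated to $\nu$, i.e. the linear map $R:X\otimes X\to X\otimes X$ given by $R(u\otimes v)=v^{(1)}\otimes\bigl(u\cdot\nu(v^{(2)})\bigr)$ for $u,v\in X$ (where $\Delta_X(v)=v^{(1)}\otimes v^{(2)}$), is a solution to the Yang-Baxter equation $$(R\otimes\mathbb{1})(\mathbb{1}\otimes R)(R\otimes\mathbb{1})=(\mathbb{1}\otimes R)(R\otimes\mathbb{1})(\mathbb{1}\otimes R).$$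
   Context: Everything is over a commutative unital ring $\mathbb{k}$; tensor products are over $\mathbb{k}$ and $\mathbb{1}$ is the identity map. A Hopf algebra $H$ has multiplication (written as juxtaposition), unit, comultiplication $\Delta_H$, counit and antipode $S$. Sweedler notation $\Delta(x)=x^{(1)}\otimes x^{(2)}$ is used with summation suppressed. *)

theory Defs
  imports "HOL-Algebra.Module" "HOL-Algebra.QuotRing"
begin

section \<open>Tensor products of modules over a commutative ring\<close>

definition linear_maps ::
    "('k, 'r) ring_scheme \<Rightarrow> ('k, 'a, 'm) module_scheme \<Rightarrow> ('k, 'b, 'n) module_scheme \<Rightarrow> ('a \<Rightarrow> 'b) set"
  where "linear_maps K M N =
    {f \<in> hom (add_monoid M) (add_monoid N).
       \<forall>a\<in>carrier K. \<forall>x\<in>carrier M. f (a \<odot>\<^bsub>M\<^esub> x) = a \<odot>\<^bsub>N\<^esub> f x}"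

text \<open>The record type of modules extends that of rings; for the modules built in this section
  the fields \<open>mult\<close> and \<open>one\<close> carry no meaning and are left undefined.\<close>

definition free_module :: "('k, 'r) ring_scheme \<Rightarrow> 's set \<Rightarrow> ('k, 's \<Rightarrow> 'k) module"
  where "free_module K S =
    \<lparr>carrier = {f. (\<forall>s. f s \<in> carrier K) \<and> (\<forall>s. s \<notin> S \<longrightarrow> f s = \<zero>\<^bsub>K\<^esub>) \<and> finite {s. f s \<noteq> \<zero>\<^bsub>K\<^esub>}},
     mult = undefined, one = undefined,
     zero = (\<lambda>s. \<zero>\<^bsub>K\<^esub>), add = (\<lambda>f g s. f s \<oplus>\<^bsub>K\<^esub> g s),
     smult = (\<lambda>a f s. a \<otimes>\<^bsub>K\<^esub> f s)\<rparr>"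

definition free_gen :: "('k, 'r) ring_scheme \<Rightarrow> 's \<Rightarrow> 's \<Rightarrow> 'k"
  where "free_gen K s = (\<lambda>t. if t = s then \<one>\<^bsub>K\<^esub> else \<zero>\<^bsub>K\<^esub>)"

definition submodule_span ::
    "('k, 'r) ring_scheme \<Rightarrow> ('k, 'a, 'm) module_scheme \<Rightarrow> 'a set \<Rightarrow> 'a set"
  where "submodule_span K M S = \<Inter>{N. submodule N K M \<and> S \<subseteq> N}"

definition quotient_module :: "('k, 'a, 'm) module_scheme \<Rightarrow> 'a set \<Rightarrow> ('k, 'a set) module"
  where "quotient_module M N =
    \<lparr>carrier = a_rcosets\<^bsub>M\<^esub> N, mult = undefined, one = undefined,
     zero = N, add = set_add M,
     smult = (\<lambda>a U. \<Union>u\<in>U. N +>\<^bsub>M\<^esub> (a \<odot>\<^bsub>M\<^esub> u))\<rparr>"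

definition tensor_relations ::
    "('k, 'r) ring_scheme \<Rightarrow> ('k, 'a, 'm) module_scheme \<Rightarrow> ('k, 'b, 'n) module_scheme
      \<Rightarrow> ('a \<times> 'b \<Rightarrow> 'k) set"
  where "tensor_relations K M N =
    (let F = free_module K (carrier M \<times> carrier N); e = (\<lambda>x y. free_gen K (x, y)) in
      {e (x \<oplus>\<^bsub>M\<^esub> x') y \<ominus>\<^bsub>F\<^esub> (e x y \<oplus>\<^bsub>F\<^esub> e x' y) | x x' y.
         x \<in> carrier M \<and> x' \<in> carrier M \<and> y \<in> carrier N} \<union>
      {e x (y \<oplus>\<^bsub>N\<^esub> y') \<ominus>\<^bsub>F\<^esub> (e x y \<oplus>\<^bsub>F\<^esub> e x y') | x y y'.
         x \<in> carrier M \<and> y \<in> carrier N \<and> y' \<in> carrier N} \<union>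
      {e (a \<odot>\<^bsub>M\<^esub> x) y \<ominus>\<^bsub>F\<^esub> a \<odot>\<^bsub>F\<^esub> e x y | a x y.
         a \<in> carrier K \<and> x \<in> carrier M \<and> y \<in> carrier N} \<union>
      {e x (a \<odot>\<^bsub>N\<^esub> y) \<ominus>\<^bsub>F\<^esub> a \<odot>\<^bsub>F\<^esub> e x y | a x y.
         a \<in> carrier K \<and> x \<in> carrier M \<and> y \<in> carrier N})"

type_synonym ('k, 'a, 'b) tensor = "('a \<times> 'b \<Rightarrow> 'k) set"

definition tensor_module ::
    "('k, 'r) ring_scheme \<Rightarrow> ('k, 'a, 'm) module_scheme \<Rightarrow> ('k, 'b, 'n) module_scheme
      \<Rightarrow> ('k, ('k, 'a, 'b) tensor) module"
  where "tensor_module K M N =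
    (let F = free_module K (carrier M \<times> carrier N)
     in quotient_module F (submodule_span K F (tensor_relations K M N)))"

definition pure_tensor ::
    "('k, 'r) ring_scheme \<Rightarrow> ('k, 'a, 'm) module_scheme \<Rightarrow> ('k, 'b, 'n) module_scheme
      \<Rightarrow> 'a \<Rightarrow> 'b \<Rightarrow> ('k, 'a, 'b) tensor"
  where "pure_tensor K M N x y =
    (let F = free_module K (carrier M \<times> carrier N)
     in submodule_span K F (tensor_relations K M N) +>\<^bsub>F\<^esub> free_gen K (x, y))"

text \<open>For bilinear \<open>\<beta> : M \<times> N \<rightarrow> P\<close>, \<open>tensor_lift K P \<beta>\<close> is the linear map
  \<open>M \<otimes> N \<rightarrow> P\<close> with \<open>x \<otimes> y \<mapsto> \<beta> x y\<close>; on a class \<open>u\<close> it evaluates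
  the formal linear combination of pairs given by any representative of \<open>u\<close>.
  In particular \<open>tensor_lift K P \<beta> (\<Delta> x)\<close> is the Sweedler expression
  \<open>\<beta> x\<^sup>(\<^sup>1\<^sup>) x\<^sup>(\<^sup>2\<^sup>)\<close>.\<close>

definition tensor_lift ::
    "('k, 'r) ring_scheme \<Rightarrow> ('k, 'c, 'p) module_scheme \<Rightarrow> ('a \<Rightarrow> 'b \<Rightarrow> 'c)
      \<Rightarrow> ('k, 'a, 'b) tensor \<Rightarrow> 'c"
  where "tensor_lift K P \<beta> u =
    (let f = (SOME f. f \<in> u)
     in \<Oplus>\<^bsub>P\<^esub>p\<in>{p. f p \<noteq> \<zero>\<^bsub>K\<^esub>}. f p \<odot>\<^bsub>P\<^esub> \<beta> (fst p) (snd p))"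

text \<open>The map \<open>f \<otimes> g\<close>, where \<open>P\<close> and \<open>Q\<close> are the codomains of \<open>f\<close> and \<open>g\<close>.\<close>

definition tensor_map ::
    "('k, 'r) ring_scheme \<Rightarrow> ('k, 'c, 'p) module_scheme \<Rightarrow> ('k, 'd, 'q) module_scheme
      \<Rightarrow> ('a \<Rightarrow> 'c) \<Rightarrow> ('b \<Rightarrow> 'd) \<Rightarrow> ('k, 'a, 'b) tensor \<Rightarrow> ('k, 'c, 'd) tensor"
  where "tensor_map K P Q f g =
    tensor_lift K (tensor_module K P Q) (\<lambda>x y. pure_tensor K P Q (f x) (g y))"

definition tensor_swap ::
    "('k, 'r) ring_scheme \<Rightarrow> ('k, 'a, 'm) module_scheme \<Rightarrow> ('k, 'b, 'n) module_scheme
      \<Rightarrow> ('k, 'a, 'b) tensor \<Rightarrow> ('k, 'b, 'a) tensor"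
  where "tensor_swap K M N = tensor_lift K (tensor_module K N M) (\<lambda>x y. pure_tensor K N M y x)"

definition tensor_assoc ::
    "('k, 'r) ring_scheme \<Rightarrow> ('k, 'a, 'm) module_scheme \<Rightarrow> ('k, 'b, 'n) module_scheme
      \<Rightarrow> ('k, 'c, 'p) module_scheme
      \<Rightarrow> ('k, ('k, 'a, 'b) tensor, 'c) tensor \<Rightarrow> ('k, 'a, ('k, 'b, 'c) tensor) tensor"
  where "tensor_assoc K M N P =
    (let NP = tensor_module K N P; T = tensor_module K M NP
     in tensor_lift K T (\<lambda>u z. tensor_lift K T
          (\<lambda>x y. pure_tensor K M NP x (pure_tensor K N P y z)) u))"

definition tensor_assoc_inv ::
    "('k, 'r) ring_scheme \<Rightarrow> ('k, 'a, 'm) module_scheme \<Rightarrow> ('k, 'b, 'n) module_scheme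
      \<Rightarrow> ('k, 'c, 'p) module_scheme
      \<Rightarrow> ('k, 'a, ('k, 'b, 'c) tensor) tensor \<Rightarrow> ('k, ('k, 'a, 'b) tensor, 'c) tensor"
  where "tensor_assoc_inv K M N P =
    (let MN = tensor_module K M N; T = tensor_module K MN P
     in tensor_lift K T (\<lambda>x v. tensor_lift K T
          (\<lambda>y z. pure_tensor K MN P (pure_tensor K M N x y) z) v))"

text \<open>The product \<open>(a \<otimes> b)(c \<otimes> d) = ac \<otimes> bd\<close> on \<open>A \<otimes> B\<close>.\<close>

definition tensor_mult ::
    "('k, 'r) ring_scheme \<Rightarrow> ('k, 'a, 'm) module_scheme \<Rightarrow> ('k, 'b, 'n) module_scheme
      \<Rightarrow> ('k, 'a, 'b) tensor \<Rightarrow> ('k, 'a, 'b) tensor \<Rightarrow> ('k, 'a, 'b) tensor"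
  where "tensor_mult K A B u v =
    (let T = tensor_module K A B
     in tensor_lift K T (\<lambda>a b. tensor_lift K T
          (\<lambda>c d. pure_tensor K A B (a \<otimes>\<^bsub>A\<^esub> c) (b \<otimes>\<^bsub>B\<^esub> d)) v) u)"


section \<open>Hopf algebras\<close>

record ('k, 'a) coalgebra = "('k, 'a) module" +
  comult :: "'a \<Rightarrow> ('k, 'a, 'a) tensor"
  counit :: "'a \<Rightarrow> 'k"

record ('k, 'a) hopf_algebra = "('k, 'a) coalgebra" +
  antipode :: "'a \<Rightarrow> 'a"

text \<open>\<open>\<epsilon>(x\<^sup>(\<^sup>1\<^sup>)) x\<^sup>(\<^sup>2\<^sup>) = x\<close> is the counit law
  \<open>(\<epsilon> \<otimes> \<one>)\<Delta> = \<one>\<close> under the canonical identification of \<open>\<k> \<otimes> C\<close> with \<open>C\<close>,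
  and similarly on the right.\<close>

locale coalgebra = module K C
  for K :: "('k, 'r) ring_scheme" (structure) and C :: "('k, 'a, 'm) coalgebra_scheme" (structure) +
  assumes comult_linear: "comult C \<in> linear_maps K C (tensor_module K C C)"
    and counit_add_hom: "counit C \<in> hom (add_monoid C) (add_monoid K)"
    and counit_smult: "\<lbrakk>a \<in> carrier K; x \<in> carrier C\<rbrakk>
      \<Longrightarrow> counit C (a \<odot>\<^bsub>C\<^esub> x) = a \<otimes>\<^bsub>K\<^esub> counit C x"
    and coassoc: "x \<in> carrier C \<Longrightarrow>
      tensor_assoc K C C C (tensor_map K (tensor_module K C C) C (comult C) id (comult C x))
      = tensor_map K C (tensor_module K C C) id (comult C) (comult C x)"
    and counit_left: "x \<in> carrier C \<Longrightarrow>
      tensor_lift K C (\<lambda>x1 x2. counit C x1 \<odot>\<^bsub>C\<^esub> x2) (comult C x) = x"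
    and counit_right: "x \<in> carrier C \<Longrightarrow>
      tensor_lift K C (\<lambda>x1 x2. counit C x2 \<odot>\<^bsub>C\<^esub> x1) (comult C x) = x"

text \<open>The library locale \<open>algebra\<close> demands a commutative multiplication; hence the axioms of
  an associative unital algebra are listed here.\<close>

locale bialgebra = coalgebra K H + H?: ring H
  for K :: "('k, 'r) ring_scheme" (structure) and H :: "('k, 'a, 'm) coalgebra_scheme" (structure) +
  assumes smult_mult_left: "\<lbrakk>a \<in> carrier K; x \<in> carrier H; y \<in> carrier H\<rbrakk>
      \<Longrightarrow> (a \<odot>\<^bsub>H\<^esub> x) \<otimes>\<^bsub>H\<^esub> y = a \<odot>\<^bsub>H\<^esub> (x \<otimes>\<^bsub>H\<^esub> y)"
    and smult_mult_right: "\<lbrakk>a \<in> carrier K; x \<in> carrier H; y \<in> carrier H\<rbrakk>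
      \<Longrightarrow> x \<otimes>\<^bsub>H\<^esub> (a \<odot>\<^bsub>H\<^esub> y) = a \<odot>\<^bsub>H\<^esub> (x \<otimes>\<^bsub>H\<^esub> y)"
    and comult_mult: "\<lbrakk>x \<in> carrier H; y \<in> carrier H\<rbrakk>
      \<Longrightarrow> comult H (x \<otimes>\<^bsub>H\<^esub> y) = tensor_mult K H H (comult H x) (comult H y)"
    and comult_one: "comult H \<one>\<^bsub>H\<^esub> = pure_tensor K H H \<one>\<^bsub>H\<^esub> \<one>\<^bsub>H\<^esub>"
    and counit_mult: "\<lbrakk>x \<in> carrier H; y \<in> carrier H\<rbrakk>
      \<Longrightarrow> counit H (x \<otimes>\<^bsub>H\<^esub> y) = counit H x \<otimes>\<^bsub>K\<^esub> counit H y"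
    and counit_one: "counit H \<one>\<^bsub>H\<^esub> = \<one>\<^bsub>K\<^esub>"

locale hopf_algebra = bialgebra K H
  for K :: "('k, 'r) ring_scheme" (structure) and H :: "('k, 'a, 'm) hopf_algebra_scheme" (structure) +
  assumes antipode_linear: "antipode H \<in> linear_maps K H H"
    and antipode_left: "x \<in> carrier H \<Longrightarrow>
      tensor_lift K H (\<lambda>x1 x2. antipode H x1 \<otimes>\<^bsub>H\<^esub> x2) (comult H x)
      = counit H x \<odot>\<^bsub>H\<^esub> \<one>\<^bsub>H\<^esub>"
    and antipode_right: "x \<in> carrier H \<Longrightarrow>
      tensor_lift K H (\<lambda>x1 x2. x1 \<otimes>\<^bsub>H\<^esub> antipode H x2) (comult H x)
      = counit H x \<odot>\<^bsub>H\<^esub> \<one>\<^bsub>H\<^esub>"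

locale cocommutative_hopf_algebra = hopf_algebra K H
  for K :: "('k, 'r) ring_scheme" (structure) and H :: "('k, 'a, 'm) hopf_algebra_scheme" (structure) +
  assumes cocommutative: "x \<in> carrier H \<Longrightarrow> tensor_swap K H H (comult H x) = comult H x"

text \<open>\<open>\<Delta>(x \<otimes> y) = (x\<^sup>(\<^sup>1\<^sup>) \<otimes> y\<^sup>(\<^sup>1\<^sup>)) \<otimes> (x\<^sup>(\<^sup>2\<^sup>) \<otimes> y\<^sup>(\<^sup>2\<^sup>))\<close>\<close>

definition tensor_comult ::
    "('k, 'r) ring_scheme \<Rightarrow> ('k, 'a, 'm) coalgebra_scheme \<Rightarrow> ('k, 'b, 'n) coalgebra_scheme
      \<Rightarrow> ('k, 'a, 'b) tensor \<Rightarrow> ('k, ('k, 'a, 'b) tensor, ('k, 'a, 'b) tensor) tensor"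
  where "tensor_comult K C D =
    (let X = tensor_module K C D; XX = tensor_module K X X
     in tensor_lift K XX (\<lambda>x y.
          tensor_lift K XX (\<lambda>x1 x2.
            tensor_lift K XX (\<lambda>y1 y2.
              pure_tensor K X X (pure_tensor K C D x1 y1) (pure_tensor K C D x2 y2))
            (comult D y))
          (comult C x)))"

text \<open>The right adjoint action \<open>ad\<^sub>g(x) = S(g\<^sup>(\<^sup>1\<^sup>)) x g\<^sup>(\<^sup>2\<^sup>)\<close>.\<close>

definition adjoint :: "('k, 'r) ring_scheme \<Rightarrow> ('k, 'a, 'm) hopf_algebra_scheme \<Rightarrow> 'a \<Rightarrow> 'a \<Rightarrow> 'a"
  where "adjoint K H g x =
    tensor_lift K H (\<lambda>g1 g2. antipode H g1 \<otimes>\<^bsub>H\<^esub> x \<otimes>\<^bsub>H\<^esub> g2) (comult H g)"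

text \<open>\<open>(x \<otimes> y) \<cdot> g = ad\<^sub>g\<^sub>(\<^sub>1\<^sub>)(x) \<otimes> ad\<^sub>g\<^sub>(\<^sub>2\<^sub>)(y)\<close>\<close>

definition tensor_adjoint ::
    "('k, 'r) ring_scheme \<Rightarrow> ('k, 'a, 'm) hopf_algebra_scheme
      \<Rightarrow> ('k, 'a, 'a) tensor \<Rightarrow> 'a \<Rightarrow> ('k, 'a, 'a) tensor"
  where "tensor_adjoint K H u g =
    (let X = tensor_module K H H
     in tensor_lift K X (\<lambda>x y.
          tensor_lift K X (\<lambda>g1 g2. pure_tensor K H H (adjoint K H g1 x) (adjoint K H g2 y))
          (comult H g)) u)"

definition mult_map ::
    "('k, 'r) ring_scheme \<Rightarrow> ('k, 'a, 'm) module_scheme \<Rightarrow> ('k, 'a, 'a) tensor \<Rightarrow> 'a"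
  where "mult_map K H = tensor_lift K H (\<lambda>x y. x \<otimes>\<^bsub>H\<^esub> y)"


section \<open>R-matrices and the Yang--Baxter equation\<close>

text \<open>\<open>R(u \<otimes> v) = v\<^sup>(\<^sup>1\<^sup>) \<otimes> (u \<cdot> \<nu>(v\<^sup>(\<^sup>2\<^sup>)))\<close>, for a comultiplication \<open>\<Delta>\<close> on \<open>X\<close>,
  a right action \<open>act\<close> of \<open>H\<close> on \<open>X\<close> and \<open>\<nu> : X \<rightarrow> H\<close>.\<close>

definition r_matrix ::
    "('k, 'r) ring_scheme \<Rightarrow> ('k, 'x, 'm) module_scheme \<Rightarrow> ('x \<Rightarrow> ('k, 'x, 'x) tensor)
      \<Rightarrow> ('x \<Rightarrow> 'h \<Rightarrow> 'x) \<Rightarrow> ('x \<Rightarrow> 'h) \<Rightarrow> ('k, 'x, 'x) tensor \<Rightarrow> ('k, 'x, 'x) tensor"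
  where "r_matrix K X \<Delta> act \<nu> =
    (let XX = tensor_module K X X
     in tensor_lift K XX (\<lambda>u v.
          tensor_lift K XX (\<lambda>v1 v2. pure_tensor K X X v1 (act u (\<nu> v2))) (\<Delta> v)))"

text \<open>Both sides are maps on \<open>(V \<otimes> V) \<otimes> V\<close>; \<open>\<one> \<otimes> R\<close> is transported there from
  \<open>V \<otimes> (V \<otimes> V)\<close> along the associator.\<close>

definition yang_baxter_solution ::
    "('k, 'r) ring_scheme \<Rightarrow> ('k, 'v, 'm) module_scheme
      \<Rightarrow> (('k, 'v, 'v) tensor \<Rightarrow> ('k, 'v, 'v) tensor) \<Rightarrow> bool"
  where "yang_baxter_solution K V R \<longleftrightarrow>
    (let VV = tensor_module K V V;
         R12 = tensor_map K VV V R id;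
         R23 = tensor_assoc_inv K V V V \<circ> tensor_map K V VV id R \<circ> tensor_assoc K V V V
     in R \<in> linear_maps K VV VV \<and>
        (\<forall>t\<in>carrier (tensor_module K VV V). (R12 \<circ> R23 \<circ> R12) t = (R23 \<circ> R12 \<circ> R23) t))"

end

theory Submission
  imports Defs
begin

text \<open>On \<open>X = H \<otimes> H\<close> put \<open>u \<triangleleft> v = u \<cdot> \<nu>(v)\<close>, so that
  \<open>R(u \<otimes> v) = v\<^sup>(\<^sup>1\<^sup>) \<otimes> (u \<triangleleft> v\<^sup>(\<^sup>2\<^sup>))\<close>. Two facts suffice, besides coassociativity and
  cocommutativity of \<open>\<Delta>\<close> on \<open>X\<close>: \<open>\<triangleleft>\<close> is a coalgebra map, and it is self-distributive,
  \<open>(u \<triangleleft> w\<^sup>(\<^sup>1\<^sup>)) \<triangleleft> (v \<triangleleft> w\<^sup>(\<^sup>2\<^sup>)) = (u \<triangleleft> v) \<triangleleft> w\<close>. The left side of the braid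
  equation sends \<open>u \<otimes> v \<otimes> w\<close> to
  \<open>w\<^sup>(\<^sup>1\<^sup>) \<otimes> (v\<^sup>(\<^sup>1\<^sup>) \<triangleleft> w\<^sup>(\<^sup>2\<^sup>)) \<otimes> ((u \<triangleleft> v\<^sup>(\<^sup>2\<^sup>)) \<triangleleft> w\<^sup>(\<^sup>3\<^sup>))\<close>, the right side to
  \<open>w\<^sup>(\<^sup>1\<^sup>) \<otimes> (v\<^sup>(\<^sup>1\<^sup>) \<triangleleft> w\<^sup>(\<^sup>3\<^sup>)) \<otimes> ((u \<triangleleft> w\<^sup>(\<^sup>2\<^sup>)) \<triangleleft> (v\<^sup>(\<^sup>2\<^sup>) \<triangleleft> w\<^sup>(\<^sup>4\<^sup>)))\<close>; cocommutativity swaps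
  \<open>w\<^sup>(\<^sup>2\<^sup>)\<close> with \<open>w\<^sup>(\<^sup>3\<^sup>)\<close> and self-distributivity absorbs the last two legs.
  Self-distributivity of \<open>\<triangleleft>\<close> reduces to \<open>g\<^sup>(\<^sup>1\<^sup>) ad\<^sub>g\<^sub>(\<^sub>2\<^sub>)(x) = x g\<close> for \<open>g = \<nu>(w)\<close>, because
  \<open>\<nu>\<close> is a coalgebra map with \<open>\<nu>(u \<cdot> g) = ad\<^sub>g(\<nu>(u))\<close>.

  Sweedler expressions are handled as values \<open>tensor_lift K P \<beta> (\<Delta> x)\<close> of bilinear maps, so that
  the coalgebra axioms become rewrite rules for nested such expressions.\<close>

section \<open>Linear maps and free modules\<close>

lemma linear_mapsI:
  assumes "\<And>x. x \<in> carrier M \<Longrightarrow> f x \<in> carrier N"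
    and "\<And>x y. \<lbrakk>x \<in> carrier M; y \<in> carrier M\<rbrakk> \<Longrightarrow> f (x \<oplus>\<^bsub>M\<^esub> y) = f x \<oplus>\<^bsub>N\<^esub> f y"
    and "\<And>a x. \<lbrakk>a \<in> carrier K; x \<in> carrier M\<rbrakk> \<Longrightarrow> f (a \<odot>\<^bsub>M\<^esub> x) = a \<odot>\<^bsub>N\<^esub> f x"
  shows "f \<in> linear_maps K M N"
  using assms by (auto simp: linear_maps_def hom_def)

lemma linear_maps_closed:
  "\<lbrakk>f \<in> linear_maps K M N; x \<in> carrier M\<rbrakk> \<Longrightarrow> f x \<in> carrier N"
  by (auto simp: linear_maps_def hom_def)

lemma linear_maps_add:
  "\<lbrakk>f \<in> linear_maps K M N; x \<in> carrier M; y \<in> carrier M\<rbrakk> \<Longrightarrow> f (x \<oplus>\<^bsub>M\<^esub> y) = f x \<oplus>\<^bsub>N\<^esub> f y"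
  by (auto simp: linear_maps_def hom_def)

lemma linear_maps_smult:
  "\<lbrakk>f \<in> linear_maps K M N; a \<in> carrier K; x \<in> carrier M\<rbrakk> \<Longrightarrow> f (a \<odot>\<^bsub>M\<^esub> x) = a \<odot>\<^bsub>N\<^esub> f x"
  by (auto simp: linear_maps_def)

lemma linear_maps_zero:
  assumes "module K M" "module K N" "f \<in> linear_maps K M N"
  shows "f \<zero>\<^bsub>M\<^esub> = \<zero>\<^bsub>N\<^esub>"
proof -
  interpret M: module K M by fact
  interpret N: module K N by fact
  show ?thesis
    using linear_maps_smult[OF assms(3) M.R.zero_closed M.M.zero_closed] linear_maps_closed[OF assms(3)]
    by simp
qed

lemma linear_maps_minus:
  assumes "module K M" "module K N" "f \<in> linear_maps K M N" "x \<in> carrier M"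
  shows "f (\<ominus>\<^bsub>M\<^esub> x) = \<ominus>\<^bsub>N\<^esub> f x"
proof -
  interpret M: module K M by fact
  interpret N: module K N by fact
  have "f (\<ominus>\<^bsub>M\<^esub> x) \<oplus>\<^bsub>N\<^esub> f x = \<zero>\<^bsub>N\<^esub>"
    using linear_maps_add[OF assms(3), of "\<ominus>\<^bsub>M\<^esub> x" x] assms linear_maps_zero[OF assms(1-3)]
    by (simp add: M.M.l_neg)
  then show ?thesis
    using assms by (intro N.M.minus_equality[symmetric]) (auto intro: linear_maps_closed)
qed

section \<open>Free modules on a set and evaluation of formal linear combinations\<close>

lemma free_module_simps [simp]:
  "f \<in> carrier (free_module K S) \<longleftrightarrow>
    (\<forall>s. f s \<in> carrier K) \<and> (\<forall>s. s \<notin> S \<longrightarrow> f s = \<zero>\<^bsub>K\<^esub>) \<and> finite {s. f s \<noteq> \<zero>\<^bsub>K\<^esub>}"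
  "\<zero>\<^bsub>free_module K S\<^esub> = (\<lambda>s. \<zero>\<^bsub>K\<^esub>)"
  "f \<oplus>\<^bsub>free_module K S\<^esub> g = (\<lambda>s. f s \<oplus>\<^bsub>K\<^esub> g s)"
  "a \<odot>\<^bsub>free_module K S\<^esub> f = (\<lambda>s. a \<otimes>\<^bsub>K\<^esub> f s)"
  by (auto simp: free_module_def)

lemma (in cring) module_free_module: "module R (free_module R S)"
proof (intro moduleI abelian_groupI)
  fix f g assume "f \<in> carrier (free_module R S)" "g \<in> carrier (free_module R S)"
  moreover from this have "finite {s. f s \<oplus> g s \<noteq> \<zero>}"
    by (auto intro!: finite_subset[of "{s. f s \<oplus> g s \<noteq> \<zero>}" "{s. f s \<noteq> \<zero>} \<union> {s. g s \<noteq> \<zero>}"])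
  ultimately show "f \<oplus>\<^bsub>free_module R S\<^esub> g \<in> carrier (free_module R S)"
    by simp
next
  fix a f assume "a \<in> carrier R" "f \<in> carrier (free_module R S)"
  moreover from this have "finite {s. a \<otimes> f s \<noteq> \<zero>}"
    by (auto intro!: finite_subset[of "{s. a \<otimes> f s \<noteq> \<zero>}" "{s. f s \<noteq> \<zero>}"])
  ultimately show "a \<odot>\<^bsub>free_module R S\<^esub> f \<in> carrier (free_module R S)"
    by simp
next
  fix f assume f: "f \<in> carrier (free_module R S)"
  have "finite {s. \<ominus> f s \<noteq> \<zero>}"
    using f by (auto intro!: finite_subset[of "{s. \<ominus> f s \<noteq> \<zero>}" "{s. f s \<noteq> \<zero>}"])
  then show "\<exists>g\<in>carrier (free_module R S). g \<oplus>\<^bsub>free_module R S\<^esub> f = \<zero>\<^bsub>free_module R S\<^esub>"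
    using f by (intro bexI[of _ "\<lambda>s. \<ominus> f s"]) (auto simp: l_neg)
qed (auto simp: fun_eq_iff a_ac m_assoc l_distr r_distr is_cring)

lemma free_gen_carrier [simp]:
  assumes "cring K" "s \<in> S"
  shows "free_gen K s \<in> carrier (free_module K S)"
proof -
  interpret cring K by fact
  show ?thesis
    using assms by (auto simp: free_gen_def intro: finite_subset[of _ "{s}"])
qed

text \<open>The sum occurring in \<open>tensor_lift\<close>, separated from the choice of a
  representative, so that its linearity can be shown on the free module first.\<close>

definition free_eval ::
    "('k, 'r) ring_scheme \<Rightarrow> ('k, 'c, 'p) module_scheme \<Rightarrow> ('s \<Rightarrow> 'c) \<Rightarrow> ('s \<Rightarrow> 'k) \<Rightarrow> 'c"
  where "free_eval K P \<beta> f = (\<Oplus>\<^bsub>P\<^esub>p\<in>{p. f p \<noteq> \<zero>\<^bsub>K\<^esub>}. f p \<odot>\<^bsub>P\<^esub> \<beta> p)"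

text \<open>Points outside the support contribute zero summands. Additivity relies on this padding,
  because \<open>f\<close>, \<open>g\<close> and their sum have different supports; the union of the
  first two serves all three.\<close>

lemma free_eval_superset:
  assumes "module K P" "\<beta> \<in> S \<rightarrow> carrier P" "f \<in> carrier (free_module K S)"
    "finite A" "{p. f p \<noteq> \<zero>\<^bsub>K\<^esub>} \<subseteq> A" "A \<subseteq> S"
  shows "free_eval K P \<beta> f = (\<Oplus>\<^bsub>P\<^esub>p\<in>A. f p \<odot>\<^bsub>P\<^esub> \<beta> p)"
proof -
  interpret module K P by fact
  have "\<beta> p \<in> carrier P" if "p \<in> A" for p
    using that assms(2,6) by auto
  then show ?thesis
    unfolding free_eval_def
    using assms(3-5) by (intro M.add.finprod_mono_neutral_cong_left) auto
qed

lemma free_eval_linear: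
  assumes P: "module K P" and b: "\<beta> \<in> S \<rightarrow> carrier P"
  shows "free_eval K P \<beta> \<in> linear_maps K (free_module K S) P"
proof -
  interpret module K P by fact
  interpret F: module K "free_module K S" by (rule R.module_free_module)
  let ?F = "free_module K S"
  have supp: "{p. f p \<noteq> \<zero>\<^bsub>K\<^esub>} \<subseteq> S" "finite {p. f p \<noteq> \<zero>\<^bsub>K\<^esub>}" if "f \<in> carrier ?F" for f
    using that by auto
  show ?thesis
  proof (rule linear_mapsI)
    fix f assume "f \<in> carrier ?F"
    then show "free_eval K P \<beta> f \<in> carrier P"
      using b unfolding free_eval_def by (intro M.finsum_closed) auto
  next
    fix f g assume fg: "f \<in> carrier ?F" "g \<in> carrier ?F"
    let ?A = "{p. f p \<noteq> \<zero>\<^bsub>K\<^esub>} \<union> {p. g p \<noteq> \<zero>\<^bsub>K\<^esub>}"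
    have A: "finite ?A" "?A \<subseteq> S" using supp fg by auto
    have "free_eval K P \<beta> (f \<oplus>\<^bsub>?F\<^esub> g) = (\<Oplus>\<^bsub>P\<^esub>p\<in>?A. (f \<oplus>\<^bsub>?F\<^esub> g) p \<odot>\<^bsub>P\<^esub> \<beta> p)"
      using fg A by (intro free_eval_superset[OF P b F.M.a_closed]) auto
    also have "\<dots> = (\<Oplus>\<^bsub>P\<^esub>p\<in>?A. f p \<odot>\<^bsub>P\<^esub> \<beta> p \<oplus>\<^bsub>P\<^esub> g p \<odot>\<^bsub>P\<^esub> \<beta> p)"
      using fg A(2) b by (intro M.finsum_cong') (auto simp: smult_l_distr Pi_iff subset_iff)
    also have "\<dots> = (\<Oplus>\<^bsub>P\<^esub>p\<in>?A. f p \<odot>\<^bsub>P\<^esub> \<beta> p) \<oplus>\<^bsub>P\<^esub> (\<Oplus>\<^bsub>P\<^esub>p\<in>?A. g p \<odot>\<^bsub>P\<^esub> \<beta> p)"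
      using fg A(2) b by (intro M.finsum_addf) (auto simp: Pi_iff subset_iff)
    also have "\<dots> = free_eval K P \<beta> f \<oplus>\<^bsub>P\<^esub> free_eval K P \<beta> g"
      using fg A by (simp only: free_eval_superset[OF P b fg(1) A(1) _ A(2)] free_eval_superset[OF P b fg(2) A(1) _ A(2)] Un_upper1 Un_upper2)
    finally show "free_eval K P \<beta> (f \<oplus>\<^bsub>?F\<^esub> g) = free_eval K P \<beta> f \<oplus>\<^bsub>P\<^esub> free_eval K P \<beta> g" .
  next
    fix a f assume af: "a \<in> carrier K" "f \<in> carrier ?F"
    let ?A = "{p. f p \<noteq> \<zero>\<^bsub>K\<^esub>}"
    have A: "finite ?A" "?A \<subseteq> S" using supp af by auto
    have "free_eval K P \<beta> (a \<odot>\<^bsub>?F\<^esub> f) = (\<Oplus>\<^bsub>P\<^esub>p\<in>?A. (a \<odot>\<^bsub>?F\<^esub> f) p \<odot>\<^bsub>P\<^esub> \<beta> p)"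
      using af A by (intro free_eval_superset[OF P b F.smult_closed]) auto
    also have "\<dots> = (\<Oplus>\<^bsub>P\<^esub>p\<in>?A. a \<odot>\<^bsub>P\<^esub> (f p \<odot>\<^bsub>P\<^esub> \<beta> p))"
      using af A(2) b by (intro M.finsum_cong') (auto simp: smult_assoc1 Pi_iff subset_iff)
    also have "\<dots> = a \<odot>\<^bsub>P\<^esub> free_eval K P \<beta> f"
      unfolding free_eval_def
      using af A b by (intro finsum_smult_ldistr[symmetric]) auto
    finally show "free_eval K P \<beta> (a \<odot>\<^bsub>?F\<^esub> f) = a \<odot>\<^bsub>P\<^esub> free_eval K P \<beta> f" .
  qed
qed

lemma free_eval_gen:
  assumes "module K P" "\<beta> s \<in> carrier P"
  shows "free_eval K P \<beta> (free_gen K s) = \<beta> s"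
proof -
  interpret module K P by fact
  show ?thesis
  \<comment> \<open>Over the zero ring the support of a generator is empty rather than
    \<open>{s}\<close>; the equation survives because every module over that ring is zero.\<close>
  proof (cases "\<one>\<^bsub>K\<^esub> = \<zero>\<^bsub>K\<^esub>")
    case True
    then have "\<beta> s = \<zero>\<^bsub>P\<^esub>"
      using smult_one[OF assms(2)] assms(2) by simp
    then show ?thesis using True by (simp add: free_eval_def free_gen_def)
  next
    case False
    then have "{p. free_gen K s p \<noteq> \<zero>\<^bsub>K\<^esub>} = {s}" by (auto simp: free_gen_def)
    then show ?thesis
      using assms unfolding free_eval_def by (simp add: free_gen_def)
  qed
qed

text \<open>Induction on a finite set containing the support: setting one value to zero splits off a
  multiple of one generator.\<close>

lemma free_module_ext:
  assumes P: "module K P"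
    and "h \<in> linear_maps K (free_module K S) P" "h' \<in> linear_maps K (free_module K S) P"
    and eq: "\<And>s. s \<in> S \<Longrightarrow> h (free_gen K s) = h' (free_gen K s)"
    and "f \<in> carrier (free_module K S)"
  shows "h f = h' f"
proof -
  interpret module K P by fact
  interpret F: module K "free_module K S" by (rule R.module_free_module)
  let ?F = "free_module K S"
  have "h f = h' f" if "finite A" "{s. f s \<noteq> \<zero>\<^bsub>K\<^esub>} \<subseteq> A" "f \<in> carrier ?F" for A f
    using that
  proof (induction A arbitrary: f)
    case empty
    then have "f = \<zero>\<^bsub>?F\<^esub>" by auto
    then show ?case
      using linear_maps_zero[OF F.module_axioms P] assms(2,3) by metis
  next
    case (insert s A)
    let ?g = "f(s := \<zero>\<^bsub>K\<^esub>)"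
    have "finite {t. ?g t \<noteq> \<zero>\<^bsub>K\<^esub>}"
      using insert.prems(2) by (auto intro: finite_subset[of _ "{s. f s \<noteq> \<zero>\<^bsub>K\<^esub>}"])
    then have g: "?g \<in> carrier ?F" using insert.prems(2) by auto
    have hg: "h ?g = h' ?g"
      using insert.prems g by (intro insert.IH) auto
    show ?case
    proof (cases "s \<in> S")
      case True
      have gen: "free_gen K s \<in> carrier ?F"
        using True R.is_cring by (rule free_gen_carrier[rotated])
      have fs: "f s \<in> carrier K" using insert.prems by auto
      have "f = ?g \<oplus>\<^bsub>?F\<^esub> f s \<odot>\<^bsub>?F\<^esub> free_gen K s"
        using insert.prems by (auto simp: free_gen_def fun_eq_iff)
      then show ?thesis
        using linear_maps_add[OF assms(2) g F.smult_closed[OF fs gen]]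
          linear_maps_add[OF assms(3) g F.smult_closed[OF fs gen]]
          linear_maps_smult[OF assms(2) fs gen] linear_maps_smult[OF assms(3) fs gen]
          hg eq[OF True]
        by metis
    next
      \<comment> \<open>A point outside \<open>S\<close> may lie in the larger set of the induction,
        but \<open>f\<close> already vanishes there.\<close>
      case False
      then have "f = ?g" using insert.prems by auto
      then show ?thesis using hg by simp
    qed
  qed
  from this[of "{s. f s \<noteq> \<zero>\<^bsub>K\<^esub>}" f] assms(5) show ?thesis by simp
qed

section \<open>Quotient modules\<close>

lemma submodule_span_submodule:
  assumes "module K M" "S \<subseteq> carrier M"
  shows "submodule (submodule_span K M S) K M"
proof -
  interpret module K M by fact
  show ?thesis
    unfolding submodule_span_def
  proof (rule submoduleI)
    \<comment> \<open>The intersected family contains \<open>carrier M\<close> itself.\<close>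
    show "\<Inter>{N. submodule N K M \<and> S \<subseteq> N} \<subseteq> carrier M"
      using carrier_is_submodule assms(2) by blast
    show "\<zero>\<^bsub>M\<^esub> \<in> \<Inter>{N. submodule N K M \<and> S \<subseteq> N}"
      using submodule.axioms(1) subgroup.one_closed by fastforce
  qed (auto dest: submoduleE)
qed

lemma span_subset: "S \<subseteq> submodule_span K M S"
  by (auto simp: submodule_span_def)

lemma submodule_span_least: "\<lbrakk>submodule N K M; S \<subseteq> N\<rbrakk> \<Longrightarrow> submodule_span K M S \<subseteq> N"
  by (auto simp: submodule_span_def)

context
  fixes K :: "('k, 'r) ring_scheme" and M :: "('k, 'a, 'm) module_scheme" and N :: "'a set"
  assumes M: "module K M" and N: "submodule N K M"
begin

interpretation M: module K M by (rule M)
interpretation N: submodule N K M by (rule N)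
interpretation N: abelian_subgroup N M
  using N.subgroup_axioms M.M.abelian_group_axioms
  by (intro abelian_subgroupI3 additive_subgroup.intro) auto

text \<open>The scalar multiple of a coset is defined as a union over all representatives
  \<open>u\<close>. Since \<open>N\<close> is closed under scalars, each of them yields the same
  coset, and the union collapses because \<open>x\<close> is one of them.\<close>

lemma quotient_smult:
  assumes "a \<in> carrier K" "x \<in> carrier M"
  shows "a \<odot>\<^bsub>quotient_module M N\<^esub> (N +>\<^bsub>M\<^esub> x) = N +>\<^bsub>M\<^esub> (a \<odot>\<^bsub>M\<^esub> x)"
proof -
  have eq: "N +>\<^bsub>M\<^esub> (a \<odot>\<^bsub>M\<^esub> u) = N +>\<^bsub>M\<^esub> (a \<odot>\<^bsub>M\<^esub> x)" if "u \<in> N +>\<^bsub>M\<^esub> x" for u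
  proof -
    obtain n where n: "n \<in> N" "u = n \<oplus>\<^bsub>M\<^esub> x"
      using \<open>u \<in> N +>\<^bsub>M\<^esub> x\<close> by (auto simp: a_r_coset_def')
    then have "a \<odot>\<^bsub>M\<^esub> u = a \<odot>\<^bsub>M\<^esub> n \<oplus>\<^bsub>M\<^esub> a \<odot>\<^bsub>M\<^esub> x"
      using assms by (simp add: M.smult_r_distr)
    then have "a \<odot>\<^bsub>M\<^esub> u \<in> N +>\<^bsub>M\<^esub> (a \<odot>\<^bsub>M\<^esub> x)"
      using n assms by (auto simp: a_r_coset_def')
    then show ?thesis
      using assms N.a_repr_independence' by (metis M.smult_closed)
  qed
  have "x \<in> N +>\<^bsub>M\<^esub> x" using assms(2) by (rule N.a_rcos_self)
  then have "(\<Union>u\<in>N +>\<^bsub>M\<^esub> x. N +>\<^bsub>M\<^esub> (a \<odot>\<^bsub>M\<^esub> u)) = N +>\<^bsub>M\<^esub> (a \<odot>\<^bsub>M\<^esub> x)"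
    using eq by (rule UN_constant_eq[OF _ ballI])
  then show ?thesis by (simp only: quotient_module_def module.simps)
qed

lemma quotient_add:
  assumes "x \<in> carrier M" "y \<in> carrier M"
  shows "(N +>\<^bsub>M\<^esub> x) \<oplus>\<^bsub>quotient_module M N\<^esub> (N +>\<^bsub>M\<^esub> y) = N +>\<^bsub>M\<^esub> (x \<oplus>\<^bsub>M\<^esub> y)"
  using assms by (simp add: quotient_module_def N.a_rcos_sum)

lemma quotient_carrier: "carrier (quotient_module M N) = (\<lambda>x. N +>\<^bsub>M\<^esub> x) ` carrier M"
  by (auto simp: quotient_module_def A_RCOSETS_def')

lemma module_quotient: "module K (quotient_module M N)"
proof (intro moduleI abelian_groupI)
  show "\<zero>\<^bsub>quotient_module M N\<^esub> \<in> carrier (quotient_module M N)"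
    using N.a_subgroup_in_rcosets by (simp add: quotient_module_def)
next
  fix u assume "u \<in> carrier (quotient_module M N)"
  then obtain x where x: "x \<in> carrier M" "u = N +>\<^bsub>M\<^esub> x"
    by (auto simp: quotient_carrier)
  have zero: "\<zero>\<^bsub>quotient_module M N\<^esub> = N +>\<^bsub>M\<^esub> \<zero>\<^bsub>M\<^esub>"
    by (simp add: quotient_module_def N.a_subset)
  show "\<zero>\<^bsub>quotient_module M N\<^esub> \<oplus>\<^bsub>quotient_module M N\<^esub> u = u"
    using x by (simp add: zero quotient_add)
  show "\<exists>v\<in>carrier (quotient_module M N). v \<oplus>\<^bsub>quotient_module M N\<^esub> u = \<zero>\<^bsub>quotient_module M N\<^esub>"
    using x by (intro bexI[of _ "N +>\<^bsub>M\<^esub> (\<ominus>\<^bsub>M\<^esub> x)"])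
      (simp_all add: zero quotient_add quotient_carrier M.M.l_neg)
next
  fix u v w assume "u \<in> carrier (quotient_module M N)" "v \<in> carrier (quotient_module M N)"
    "w \<in> carrier (quotient_module M N)"
  then obtain x y z where "x \<in> carrier M" "u = N +>\<^bsub>M\<^esub> x" "y \<in> carrier M" "v = N +>\<^bsub>M\<^esub> y"
    "z \<in> carrier M" "w = N +>\<^bsub>M\<^esub> z"
    by (auto simp: quotient_carrier)
  then show "u \<oplus>\<^bsub>quotient_module M N\<^esub> v \<oplus>\<^bsub>quotient_module M N\<^esub> w
      = u \<oplus>\<^bsub>quotient_module M N\<^esub> (v \<oplus>\<^bsub>quotient_module M N\<^esub> w)"
    by (simp add: quotient_add M.M.a_assoc)
next
  fix u v assume "u \<in> carrier (quotient_module M N)" "v \<in> carrier (quotient_module M N)"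
  then obtain x y where xy: "x \<in> carrier M" "u = N +>\<^bsub>M\<^esub> x" "y \<in> carrier M" "v = N +>\<^bsub>M\<^esub> y"
    by (auto simp: quotient_carrier)
  then show "u \<oplus>\<^bsub>quotient_module M N\<^esub> v = v \<oplus>\<^bsub>quotient_module M N\<^esub> u"
    by (simp add: quotient_add M.M.a_comm)
  show "u \<oplus>\<^bsub>quotient_module M N\<^esub> v \<in> carrier (quotient_module M N)"
    using xy by (simp add: quotient_add quotient_carrier)
  show "a \<odot>\<^bsub>quotient_module M N\<^esub> (u \<oplus>\<^bsub>quotient_module M N\<^esub> v)
      = a \<odot>\<^bsub>quotient_module M N\<^esub> u \<oplus>\<^bsub>quotient_module M N\<^esub> a \<odot>\<^bsub>quotient_module M N\<^esub> v"
    if "a \<in> carrier K" for a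
    using xy that by (simp add: quotient_add quotient_smult M.smult_r_distr)
next
  fix a b u assume ab: "a \<in> carrier K" "b \<in> carrier K" and "u \<in> carrier (quotient_module M N)"
  then obtain x where x: "x \<in> carrier M" "u = N +>\<^bsub>M\<^esub> x"
    by (auto simp: quotient_carrier)
  then show "(a \<oplus>\<^bsub>K\<^esub> b) \<odot>\<^bsub>quotient_module M N\<^esub> u
      = a \<odot>\<^bsub>quotient_module M N\<^esub> u \<oplus>\<^bsub>quotient_module M N\<^esub> b \<odot>\<^bsub>quotient_module M N\<^esub> u"
    using ab by (simp add: quotient_add quotient_smult M.smult_l_distr)
  show "(a \<otimes>\<^bsub>K\<^esub> b) \<odot>\<^bsub>quotient_module M N\<^esub> u
      = a \<odot>\<^bsub>quotient_module M N\<^esub> (b \<odot>\<^bsub>quotient_module M N\<^esub> u)"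
    using ab x by (simp add: quotient_smult M.smult_assoc1)
next
  fix a u assume a: "a \<in> carrier K" and "u \<in> carrier (quotient_module M N)"
  then obtain x where x: "x \<in> carrier M" "u = N +>\<^bsub>M\<^esub> x"
    by (auto simp: quotient_carrier)
  then show "a \<odot>\<^bsub>quotient_module M N\<^esub> u \<in> carrier (quotient_module M N)"
    using a by (simp add: quotient_smult quotient_carrier)
next
  fix u assume "u \<in> carrier (quotient_module M N)"
  then obtain x where x: "x \<in> carrier M" "u = N +>\<^bsub>M\<^esub> x"
    by (auto simp: quotient_carrier)
  then show "\<one>\<^bsub>K\<^esub> \<odot>\<^bsub>quotient_module M N\<^esub> u = u"
    by (simp add: quotient_smult)
qed (rule M.R.is_cring)

lemma quotient_linear: "(\<lambda>x. N +>\<^bsub>M\<^esub> x) \<in> linear_maps K M (quotient_module M N)"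
proof (rule linear_mapsI)
  fix x assume "x \<in> carrier M"
  then show "N +>\<^bsub>M\<^esub> x \<in> carrier (quotient_module M N)"
    unfolding quotient_carrier by (rule imageI)
next
  fix x y assume "x \<in> carrier M" "y \<in> carrier M"
  then show "N +>\<^bsub>M\<^esub> (x \<oplus>\<^bsub>M\<^esub> y) = (N +>\<^bsub>M\<^esub> x) \<oplus>\<^bsub>quotient_module M N\<^esub> (N +>\<^bsub>M\<^esub> y)"
    by (rule quotient_add[symmetric])
next
  fix a x assume "a \<in> carrier K" "x \<in> carrier M"
  then show "N +>\<^bsub>M\<^esub> (a \<odot>\<^bsub>M\<^esub> x) = a \<odot>\<^bsub>quotient_module M N\<^esub> (N +>\<^bsub>M\<^esub> x)"
    by (rule quotient_smult[symmetric])
qed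

text \<open>Any two representatives differ by an element of \<open>N\<close>, which \<open>h\<close>
  kills. This makes the \<open>SOME\<close> in \<open>tensor_lift\<close> harmless.\<close>

lemma quotient_representative:
  assumes P: "module K P" and h: "h \<in> linear_maps K M P"
    and "\<And>n. n \<in> N \<Longrightarrow> h n = \<zero>\<^bsub>P\<^esub>" and x: "x \<in> carrier M"
  shows "h (SOME f. f \<in> N +>\<^bsub>M\<^esub> x) = h x"
proof -
  interpret P: module K P by fact
  have "(SOME f. f \<in> N +>\<^bsub>M\<^esub> x) \<in> N +>\<^bsub>M\<^esub> x"
    using N.a_rcos_self[OF x] by (rule someI[of "\<lambda>f. f \<in> N +>\<^bsub>M\<^esub> x"])
  then obtain n where n: "n \<in> N" "(SOME f. f \<in> N +>\<^bsub>M\<^esub> x) = n \<oplus>\<^bsub>M\<^esub> x"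
    by (auto simp: a_r_coset_def')
  then show ?thesis
    using assms linear_maps_closed[OF h x] by (simp add: linear_maps_add[OF h])
qed

end

section \<open>The universal property of the tensor product\<close>

definition bilinear ::
    "('k, 'r) ring_scheme \<Rightarrow> ('k, 'a, 'm) module_scheme \<Rightarrow> ('k, 'b, 'n) module_scheme
      \<Rightarrow> ('k, 'c, 'p) module_scheme \<Rightarrow> ('a \<Rightarrow> 'b \<Rightarrow> 'c) \<Rightarrow> bool"
  where "bilinear K M N P \<beta> \<longleftrightarrow>
    (\<forall>y\<in>carrier N. (\<lambda>x. \<beta> x y) \<in> linear_maps K M P) \<and>
    (\<forall>x\<in>carrier M. (\<lambda>y. \<beta> x y) \<in> linear_maps K N P)"

lemma bilinearI [intro?]:
  assumes "\<And>y. y \<in> carrier N \<Longrightarrow> (\<lambda>x. \<beta> x y) \<in> linear_maps K M P"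
    and "\<And>x. x \<in> carrier M \<Longrightarrow> (\<lambda>y. \<beta> x y) \<in> linear_maps K N P"
  shows "bilinear K M N P \<beta>"
  using assms by (simp add: bilinear_def)

lemma bilinear_left: "\<lbrakk>bilinear K M N P \<beta>; y \<in> carrier N\<rbrakk> \<Longrightarrow> (\<lambda>x. \<beta> x y) \<in> linear_maps K M P"
  by (simp add: bilinear_def)

lemma bilinear_right: "\<lbrakk>bilinear K M N P \<beta>; x \<in> carrier M\<rbrakk> \<Longrightarrow> (\<lambda>y. \<beta> x y) \<in> linear_maps K N P"
  by (simp add: bilinear_def)

lemma bilinear_closed:
  "\<lbrakk>bilinear K M N P \<beta>; x \<in> carrier M; y \<in> carrier N\<rbrakk> \<Longrightarrow> \<beta> x y \<in> carrier P"
  by (drule (1) bilinear_right, erule (1) linear_maps_closed)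

text \<open>The two products are compared through the inductive graph \<open>foldSetD\<close> of the
  fold, which makes sense for any \<open>G\<close>. Integrands can thus be rewritten before their
  values are known to lie in the carrier.\<close>

lemma finprod_cong_on:
  assumes "\<And>i. i \<in> A \<Longrightarrow> f i = g i"
  shows "finprod G f A = finprod G g A"
proof -
  have "(B, x) \<in> foldSetD D (mult G \<circ> g) e"
    if "(B, x) \<in> foldSetD D (mult G \<circ> f) e" "B \<subseteq> A" "\<And>i. i \<in> A \<Longrightarrow> f i = g i"
    for B x D e and f g :: "'a \<Rightarrow> 'b"
    using that by (induction rule: foldSetD.induct) (auto intro: foldSetD.emptyI foldSetD.insertI[where f = "mult G \<circ> g", simplified])
  then have "(A, x) \<in> foldSetD D (mult G \<circ> f) e \<longleftrightarrow> (A, x) \<in> foldSetD D (mult G \<circ> g) e" for x D e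
    using assms by (metis order_refl)
  then show ?thesis
    by (simp add: finprod_def foldD_def)
qed

lemma linear_maps_comp:
  "\<lbrakk>f \<in> linear_maps K N P; g \<in> linear_maps K M N\<rbrakk> \<Longrightarrow> (\<lambda>x. f (g x)) \<in> linear_maps K M P"
  by (rule linear_mapsI) (simp_all add: linear_maps_closed linear_maps_add linear_maps_smult)

lemma linear_maps_cong:
  assumes "module K M" "\<And>x. x \<in> carrier M \<Longrightarrow> f x = g x" "g \<in> linear_maps K M N"
  shows "f \<in> linear_maps K M N"
proof -
  interpret module K M by fact
  show ?thesis
    using assms(2) linear_maps_closed[OF assms(3)] linear_maps_add[OF assms(3)] linear_maps_smult[OF assms(3)]
    by (intro linear_mapsI) simp_all
qed

lemma bilinear_cong:
  assumes "module K M" "module K N"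
    "\<And>x y. \<lbrakk>x \<in> carrier M; y \<in> carrier N\<rbrakk> \<Longrightarrow> \<beta> x y = \<gamma> x y" "bilinear K M N P \<gamma>"
  shows "bilinear K M N P \<beta>"
  using assms(3)
  by (intro bilinearI linear_maps_cong[OF assms(1) _ bilinear_left[OF assms(4)]]
      linear_maps_cong[OF assms(2) _ bilinear_right[OF assms(4)]])

section \<open>The tensor product as a quotient: pure tensors and lifts of bilinear maps\<close>

context
  fixes K :: "('k, 'r) ring_scheme" and M :: "('k, 'a, 'm) module_scheme" and N :: "('k, 'b, 'n) module_scheme"
  assumes M: "module K M" and N: "module K N"
begin

interpretation M: module K M by (rule M)
interpretation N: module K N by (rule N)

abbreviation (input) "Fr \<equiv> free_module K (carrier M \<times> carrier N)"
abbreviation (input) "Rel \<equiv> submodule_span K Fr (tensor_relations K M N)"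

interpretation Fr: module K Fr by (rule M.R.module_free_module)

lemma free_gen_pair: "\<lbrakk>x \<in> carrier M; y \<in> carrier N\<rbrakk> \<Longrightarrow> free_gen K (x, y) \<in> carrier Fr"
  by (intro free_gen_carrier M.R.is_cring) simp

lemma tensor_relations_closed: "tensor_relations K M N \<subseteq> carrier Fr"
proof -
  have "u \<ominus>\<^bsub>Fr\<^esub> v \<in> carrier Fr" if "u \<in> carrier Fr" "v \<in> carrier Fr" for u v
    using that by (rule Fr.M.minus_closed)
  moreover have "u \<oplus>\<^bsub>Fr\<^esub> v \<in> carrier Fr" if "u \<in> carrier Fr" "v \<in> carrier Fr" for u v
    using that by (rule Fr.M.a_closed)
  moreover have "a \<odot>\<^bsub>Fr\<^esub> v \<in> carrier Fr" if "a \<in> carrier K" "v \<in> carrier Fr" for a v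
    using that by (rule Fr.smult_closed)
  ultimately show ?thesis
    unfolding tensor_relations_def Let_def
    by (auto simp del: free_module_simps intro: free_gen_pair)
qed

lemma linear_minus_eq_zero_iff:
  assumes P: "module K P" and h: "h \<in> linear_maps K Fr P" and uv: "u \<in> carrier Fr" "v \<in> carrier Fr"
  shows "h (u \<ominus>\<^bsub>Fr\<^esub> v) = \<zero>\<^bsub>P\<^esub> \<longleftrightarrow> h u = h v"
proof -
  interpret P: module K P by fact
  have "h (u \<ominus>\<^bsub>Fr\<^esub> v) = h u \<ominus>\<^bsub>P\<^esub> h v"
    using uv by (simp only: a_minus_def linear_maps_add[OF h uv(1) Fr.M.a_inv_closed]
        linear_maps_minus[OF Fr.module_axioms P h])
  then show ?thesis
    using linear_maps_closed[OF h uv(1)] linear_maps_closed[OF h uv(2)]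
    by (metis P.M.minus_eq P.M.r_neg P.M.minus_equality P.M.minus_minus P.M.a_inv_closed)
qed

text \<open>The four families of relations are additivity and homogeneity in each argument, written
  as differences. Read from left to right this gives bilinearity of pure tensors, from right to left
  well-definedness of lifts.\<close>

lemma tensor_relations_null_iff:
  assumes P: "module K P" and h: "h \<in> linear_maps K Fr P"
  shows "(\<forall>r\<in>tensor_relations K M N. h r = \<zero>\<^bsub>P\<^esub>) \<longleftrightarrow> bilinear K M N P (\<lambda>x y. h (free_gen K (x, y)))"
    (is "?L \<longleftrightarrow> bilinear K M N P ?b")
proof -
  note [simp del] = free_module_simps
  note [simp] = linear_minus_eq_zero_iff[OF P h] linear_maps_add[OF h] linear_maps_smult[OF h]
    linear_maps_closed[OF h] free_gen_pair
  have all: "(\<forall>r\<in>{f u v w |u v w. A u v w}. B r) \<longleftrightarrow> (\<forall>u v w. A u v w \<longrightarrow> B (f u v w))"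
    for f :: "'u \<Rightarrow> 'v \<Rightarrow> 'w \<Rightarrow> 'z" and A B
    by auto
  have "?L \<longleftrightarrow>
      (\<forall>x\<in>carrier M. \<forall>x'\<in>carrier M. \<forall>y\<in>carrier N. ?b (x \<oplus>\<^bsub>M\<^esub> x') y = ?b x y \<oplus>\<^bsub>P\<^esub> ?b x' y) \<and>
      (\<forall>x\<in>carrier M. \<forall>y\<in>carrier N. \<forall>y'\<in>carrier N. ?b x (y \<oplus>\<^bsub>N\<^esub> y') = ?b x y \<oplus>\<^bsub>P\<^esub> ?b x y') \<and>
      (\<forall>a\<in>carrier K. \<forall>x\<in>carrier M. \<forall>y\<in>carrier N. ?b (a \<odot>\<^bsub>M\<^esub> x) y = a \<odot>\<^bsub>P\<^esub> ?b x y) \<and>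
      (\<forall>a\<in>carrier K. \<forall>x\<in>carrier M. \<forall>y\<in>carrier N. ?b x (a \<odot>\<^bsub>N\<^esub> y) = a \<odot>\<^bsub>P\<^esub> ?b x y)"
    unfolding tensor_relations_def Let_def ball_Un conj_assoc all
    by (intro arg_cong2[of _ _ _ _ "(\<and>)"]; simp add: Ball_def cong: imp_cong; blast)
  also have "\<dots> \<longleftrightarrow> bilinear K M N P ?b"
    by (auto simp: bilinear_def linear_maps_def hom_def)
  finally show ?thesis .
qed

lemma Rel_submodule: "submodule Rel K Fr"
  by (rule submodule_span_submodule[OF Fr.module_axioms tensor_relations_closed])

lemma tensor_module_quotient: "tensor_module K M N = quotient_module Fr Rel"
  by (simp add: tensor_module_def Let_def)

lemma module_tensor: "module K (tensor_module K M N)"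
  unfolding tensor_module_quotient by (rule module_quotient[OF Fr.module_axioms Rel_submodule])

lemma class_linear: "(\<lambda>f. Rel +>\<^bsub>Fr\<^esub> f) \<in> linear_maps K Fr (tensor_module K M N)"
  unfolding tensor_module_quotient by (rule quotient_linear[OF Fr.module_axioms Rel_submodule])

lemma pure_tensor_class: "pure_tensor K M N x y = Rel +>\<^bsub>Fr\<^esub> free_gen K (x, y)"
  by (simp add: pure_tensor_def Let_def)

text \<open>The class map sends every relation to the zero coset.\<close>

lemma bilinear_pure: "bilinear K M N (tensor_module K M N) (pure_tensor K M N)"
proof -
  interpret S: submodule Rel K Fr by (rule Rel_submodule)
  have "Rel +>\<^bsub>Fr\<^esub> r = \<zero>\<^bsub>tensor_module K M N\<^esub>" if "r \<in> tensor_relations K M N" for r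
  proof -
    have "Rel +>\<^bsub>Fr\<^esub> r = Rel"
      using subsetD[OF tensor_relations_closed that] S.subgroup_axioms subsetD[OF span_subset that]
      by (rule Fr.M.a_coset_join2)
    then show ?thesis by (simp add: tensor_module_quotient quotient_module_def)
  qed
  then show ?thesis
    using tensor_relations_null_iff[OF module_tensor class_linear] by (simp add: pure_tensor_class[abs_def])
qed

lemma tensor_lift_eval:
  "tensor_lift K P \<beta> u = free_eval K P (\<lambda>p. \<beta> (fst p) (snd p)) (SOME f. f \<in> u)"
  by (simp add: tensor_lift_def free_eval_def Let_def)

text \<open>The kernel of the evaluation is a submodule containing the relations, hence also their
  span; so the chosen representative may be replaced by \<open>f\<close>.\<close>

lemma tensor_lift_class:
  assumes P: "module K P" and b: "bilinear K M N P \<beta>" and f: "f \<in> carrier Fr"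
  shows "tensor_lift K P \<beta> (Rel +>\<^bsub>Fr\<^esub> f) = free_eval K P (\<lambda>p. \<beta> (fst p) (snd p)) f"
proof -
  interpret P: module K P by (rule P)
  let ?e = "free_eval K P (\<lambda>p. \<beta> (fst p) (snd p))"
  have e: "?e \<in> linear_maps K Fr P"
    using bilinear_closed[OF b] by (intro free_eval_linear P) auto
  have "?e (free_gen K (x, y)) = \<beta> x y" if "x \<in> carrier M" "y \<in> carrier N" for x y
    using bilinear_closed[OF b] that by (simp add: free_eval_gen[OF P])
  then have "bilinear K M N P (\<lambda>x y. ?e (free_gen K (x, y)))"
    using b by (rule bilinear_cong[OF M N])
  then have "\<forall>r\<in>tensor_relations K M N. ?e r = \<zero>\<^bsub>P\<^esub>"
    using tensor_relations_null_iff[OF P e] by blast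
  moreover have "submodule {f \<in> carrier Fr. ?e f = \<zero>\<^bsub>P\<^esub>} K Fr"
    by (rule Fr.submoduleI)
      (auto simp: linear_maps_add[OF e] linear_maps_smult[OF e] linear_maps_minus[OF Fr.module_axioms P e]
        linear_maps_zero[OF Fr.module_axioms P e] simp del: free_module_simps)
  ultimately have "Rel \<subseteq> {f \<in> carrier Fr. ?e f = \<zero>\<^bsub>P\<^esub>}"
    using tensor_relations_closed by (intro submodule_span_least) auto
  then show ?thesis
    unfolding tensor_lift_eval
    by (intro quotient_representative[OF Fr.module_axioms Rel_submodule P e _ f]) blast
qed

lemma tensor_carrier: "carrier (tensor_module K M N) = (\<lambda>f. Rel +>\<^bsub>Fr\<^esub> f) ` carrier Fr"
  unfolding tensor_module_quotient by (rule quotient_carrier[OF Fr.module_axioms Rel_submodule])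

lemma tensor_lift_linear:
  assumes P: "module K P" and b: "bilinear K M N P \<beta>"
  shows "tensor_lift K P \<beta> \<in> linear_maps K (tensor_module K M N) P"
proof -
  let ?e = "free_eval K P (\<lambda>p. \<beta> (fst p) (snd p))"
  have e: "?e \<in> linear_maps K Fr P"
    using bilinear_closed[OF b] by (intro free_eval_linear P) auto
  note [simp del] = free_module_simps
  note [simp] = linear_maps_add[OF class_linear, symmetric] linear_maps_smult[OF class_linear, symmetric]
    tensor_lift_class[OF P b] linear_maps_add[OF e] linear_maps_smult[OF e] linear_maps_closed[OF e]
  show ?thesis
    by (rule linear_mapsI) (auto simp: tensor_carrier)
qed

lemma tensor_lift_pure:
  assumes "module K P" "bilinear K M N P \<beta>" "x \<in> carrier M" "y \<in> carrier N"
  shows "tensor_lift K P \<beta> (pure_tensor K M N x y) = \<beta> x y"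
  using assms bilinear_closed[OF assms(2)]
  by (simp add: pure_tensor_class tensor_lift_class free_gen_pair free_eval_gen del: free_module_simps)

text \<open>Composed with the class map, both sides become linear maps on the free module, where
  agreement on generators suffices. Nearly all identities of tensors below are reduced to pure
  tensors by this rule.\<close>

lemma tensor_ext:
  assumes P: "module K P"
    and h: "h \<in> linear_maps K (tensor_module K M N) P" "h' \<in> linear_maps K (tensor_module K M N) P"
    and eq: "\<And>x y. \<lbrakk>x \<in> carrier M; y \<in> carrier N\<rbrakk> \<Longrightarrow> h (pure_tensor K M N x y) = h' (pure_tensor K M N x y)"
    and "t \<in> carrier (tensor_module K M N)"
  shows "h t = h' t"
proof -
  obtain f where f: "f \<in> carrier Fr" "t = Rel +>\<^bsub>Fr\<^esub> f"
    using assms(5) by (auto simp: tensor_carrier simp del: free_module_simps)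
  show ?thesis
    unfolding f(2)
    by (rule free_module_ext[OF P linear_maps_comp[OF h(1) class_linear] linear_maps_comp[OF h(2) class_linear] _ f(1)])
      (use eq in \<open>auto simp: pure_tensor_class\<close>)
qed

text \<open>The chosen representative lies in the free module, so it is supported on pairs from the
  carriers. The sums are then compared term by term, without passing through bilinearity.\<close>

lemma tensor_lift_cong:
  assumes t: "t \<in> carrier (tensor_module K M N)"
    and eq: "\<And>x y. \<lbrakk>x \<in> carrier M; y \<in> carrier N\<rbrakk> \<Longrightarrow> \<beta> x y = \<gamma> x y"
  shows "tensor_lift K P \<beta> t = tensor_lift K P \<gamma> t"
proof -
  interpret S: submodule Rel K Fr by (rule Rel_submodule)
  obtain f where f: "f \<in> carrier Fr" "t = Rel +>\<^bsub>Fr\<^esub> f"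
    using t by (auto simp: tensor_carrier simp del: free_module_simps)
  have "Rel +>\<^bsub>Fr\<^esub> f \<subseteq> carrier Fr"
    using S.subset f(1) by (intro Fr.M.a_r_coset_subset_G) auto
  moreover have "f \<in> t"
    unfolding f(2) using S.subgroup_axioms f(1)
    by (intro abelian_subgroup.a_rcos_self abelian_subgroupI3 additive_subgroup.intro Fr.M.abelian_group_axioms)
  ultimately have "(SOME f. f \<in> t) \<in> carrier Fr"
    unfolding f(2)[symmetric] using someI[of "\<lambda>f. f \<in> t" f] by auto
  then have "{p. (SOME f. f \<in> t) p \<noteq> \<zero>\<^bsub>K\<^esub>} \<subseteq> carrier M \<times> carrier N"
    by auto
  then show ?thesis
    unfolding tensor_lift_def Let_def finsum_def using eq by (intro finprod_cong_on) auto
qed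

end

section \<open>Linearity rules and exchange laws for lifts\<close>

lemma lin_id: "(\<lambda>x. x) \<in> linear_maps K M M"
  by (rule linear_mapsI) simp_all

text \<open>The inner map \<open>g\<close> is a variable, so that the rule peels one layer off a
  nested expression at a time.\<close>

lemma lin_bilinear_left:
  "\<lbrakk>bilinear K M N P \<beta>; g \<in> linear_maps K Q M; y \<in> carrier N\<rbrakk> \<Longrightarrow> (\<lambda>x. \<beta> (g x) y) \<in> linear_maps K Q P"
  by (rule linear_maps_comp[OF bilinear_left])

lemma lin_bilinear_right:
  "\<lbrakk>bilinear K M N P \<beta>; g \<in> linear_maps K Q N; x \<in> carrier M\<rbrakk> \<Longrightarrow> (\<lambda>y. \<beta> x (g y)) \<in> linear_maps K Q P"
  by (rule linear_maps_comp[OF bilinear_right])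

lemma lin_pure_left:
  "\<lbrakk>module K M; module K N; g \<in> linear_maps K Q M; y \<in> carrier N\<rbrakk>
    \<Longrightarrow> (\<lambda>x. pure_tensor K M N (g x) y) \<in> linear_maps K Q (tensor_module K M N)"
  by (rule lin_bilinear_left[OF bilinear_pure])

lemma lin_pure_right:
  "\<lbrakk>module K M; module K N; g \<in> linear_maps K Q N; x \<in> carrier M\<rbrakk>
    \<Longrightarrow> (\<lambda>y. pure_tensor K M N x (g y)) \<in> linear_maps K Q (tensor_module K M N)"
  by (rule lin_bilinear_right[OF bilinear_pure])

lemma pure_closed:
  "\<lbrakk>module K M; module K N; x \<in> carrier M; y \<in> carrier N\<rbrakk>
    \<Longrightarrow> pure_tensor K M N x y \<in> carrier (tensor_module K M N)"
  by (rule bilinear_closed[OF bilinear_pure])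

lemma lift_closed:
  "\<lbrakk>module K M; module K N; module K P; bilinear K M N P \<beta>; t \<in> carrier (tensor_module K M N)\<rbrakk>
    \<Longrightarrow> tensor_lift K P \<beta> t \<in> carrier P"
  by (rule linear_maps_closed[OF tensor_lift_linear])

lemma lin_lift_arg:
  "\<lbrakk>module K M; module K N; module K P; bilinear K M N P \<beta>; g \<in> linear_maps K Q (tensor_module K M N)\<rbrakk>
    \<Longrightarrow> (\<lambda>x. tensor_lift K P \<beta> (g x)) \<in> linear_maps K Q P"
  by (rule linear_maps_comp[OF tensor_lift_linear])

text \<open>Both sides are linear in \<open>t\<close> and agree on pure tensors. In Sweedler
  notation: linear maps may be moved in and out of the suppressed sum.\<close>

lemma linear_lift:
  assumes "module K M" "module K N" "module K P" "module K Q"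
    and h: "h \<in> linear_maps K P Q" and b: "bilinear K M N P \<beta>" and t: "t \<in> carrier (tensor_module K M N)"
  shows "h (tensor_lift K P \<beta> t) = tensor_lift K Q (\<lambda>x y. h (\<beta> x y)) t"
proof (rule tensor_ext[OF assms(1,2,4) _ _ _ t])
  have hb: "bilinear K M N Q (\<lambda>x y. h (\<beta> x y))"
    by (intro bilinearI linear_maps_comp[OF h] bilinear_left[OF b] bilinear_right[OF b])
  show "(\<lambda>t. h (tensor_lift K P \<beta> t)) \<in> linear_maps K (tensor_module K M N) Q"
    by (intro linear_maps_comp[OF h] tensor_lift_linear assms)
  show "tensor_lift K Q (\<lambda>x y. h (\<beta> x y)) \<in> linear_maps K (tensor_module K M N) Q"
    by (intro tensor_lift_linear hb assms)
  show "h (tensor_lift K P \<beta> (pure_tensor K M N x y))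
      = tensor_lift K Q (\<lambda>x y. h (\<beta> x y)) (pure_tensor K M N x y)"
    if "x \<in> carrier M" "y \<in> carrier N" for x y
    using that b hb assms by (simp add: tensor_lift_pure)
qed

text \<open>The identity is the lift of the universal bilinear map. It allows a bare tensor such as
  \<open>\<Delta> x\<close> to be written as a Sweedler expression.\<close>

lemma lift_pure_tensor:
  assumes "module K M" "module K N" "t \<in> carrier (tensor_module K M N)"
  shows "tensor_lift K (tensor_module K M N) (pure_tensor K M N) t = t"
  by (rule tensor_ext[OF assms(1,2) module_tensor[OF assms(1,2)] _ lin_id _ assms(3)])
    (simp_all add: assms tensor_lift_pure tensor_lift_linear bilinear_pure module_tensor)

text \<open>Complements \<open>lin_lift_arg\<close>: here the tensor is fixed and the integrand
  depends on a parameter. For each law both sides are regarded as linear in \<open>t\<close>; on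
  pure tensors the law is linearity of \<open>\<beta>\<close> in its first argument.\<close>

lemma lin_lift_body:
  assumes M: "module K M" and N: "module K N" and P: "module K P" and Q: "module K Q"
    and t: "t \<in> carrier (tensor_module K M N)"
    and lin: "\<And>x y. \<lbrakk>x \<in> carrier M; y \<in> carrier N\<rbrakk> \<Longrightarrow> (\<lambda>z. \<beta> z x y) \<in> linear_maps K Q P"
    and bil: "\<And>z. z \<in> carrier Q \<Longrightarrow> bilinear K M N P (\<beta> z)"
  shows "(\<lambda>z. tensor_lift K P (\<beta> z) t) \<in> linear_maps K Q P"
proof -
  interpret P: module K P by (rule P)
  interpret Q: module K Q by (rule Q)
  interpret T: module K "tensor_module K M N" by (rule module_tensor[OF M N])
  have L: "tensor_lift K P (\<beta> z) \<in> linear_maps K (tensor_module K M N) P" if "z \<in> carrier Q" for z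
    by (rule tensor_lift_linear[OF M N P bil[OF that]])
  note L_closed = linear_maps_closed[OF L]
  note L_add = linear_maps_add[OF L]
  note L_smult = linear_maps_smult[OF L]
  note l_closed = linear_maps_closed[OF lin]
  show ?thesis
  proof (rule linear_mapsI)
    show "tensor_lift K P (\<beta> z) t \<in> carrier P" if "z \<in> carrier Q" for z
      using L_closed[OF that t] .
    show "tensor_lift K P (\<beta> (z \<oplus>\<^bsub>Q\<^esub> w)) t = tensor_lift K P (\<beta> z) t \<oplus>\<^bsub>P\<^esub> tensor_lift K P (\<beta> w) t"
      if z: "z \<in> carrier Q" and w: "w \<in> carrier Q" for z w
    proof (rule tensor_ext[OF M N P L _ _ t])
      show "(\<lambda>t. tensor_lift K P (\<beta> z) t \<oplus>\<^bsub>P\<^esub> tensor_lift K P (\<beta> w) t) \<in> linear_maps K (tensor_module K M N) P"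
        using z w by (intro linear_mapsI)
          (simp_all add: L_closed L_add L_smult P.smult_r_distr P.M.a_ac)
    qed (use z w in \<open>simp_all add: tensor_lift_pure[OF M N P] bil linear_maps_add[OF lin]\<close>)
    show "tensor_lift K P (\<beta> (a \<odot>\<^bsub>Q\<^esub> z)) t = a \<odot>\<^bsub>P\<^esub> tensor_lift K P (\<beta> z) t"
      if a: "a \<in> carrier K" and z: "z \<in> carrier Q" for a z
    proof (rule tensor_ext[OF M N P L _ _ t])
      show "(\<lambda>t. a \<odot>\<^bsub>P\<^esub> tensor_lift K P (\<beta> z) t) \<in> linear_maps K (tensor_module K M N) P"
        using a z by (intro linear_mapsI)
          (simp_all add: L_closed L_add L_smult P.smult_r_distr P.smult_assoc1[symmetric] P.R.m_comm)
    qed (use a z in \<open>simp_all add: tensor_lift_pure[OF M N P] bil linear_maps_smult[OF lin]\<close>)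
  qed
qed

text \<open>By linearity it suffices to take \<open>t\<close> pure; then the sum over
  \<open>t\<close> disappears on both sides and the same sum over \<open>s\<close> remains.\<close>

lemma lift_fubini:
  assumes mods: "module K M" "module K N" "module K M'" "module K N'" "module K P"
    and t: "t \<in> carrier (tensor_module K M N)" and s: "s \<in> carrier (tensor_module K M' N')"
    and b1: "\<And>c d. \<lbrakk>c \<in> carrier M'; d \<in> carrier N'\<rbrakk> \<Longrightarrow> bilinear K M N P (\<lambda>a b. \<tau> a b c d)"
    and b2: "\<And>a b. \<lbrakk>a \<in> carrier M; b \<in> carrier N\<rbrakk> \<Longrightarrow> bilinear K M' N' P (\<lambda>c d. \<tau> a b c d)"
  shows "tensor_lift K P (\<lambda>a b. tensor_lift K P (\<lambda>c d. \<tau> a b c d) s) t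
    = tensor_lift K P (\<lambda>c d. tensor_lift K P (\<lambda>a b. \<tau> a b c d) t) s"
proof (rule tensor_ext[OF mods(1,2,5) _ _ _ t])
  have bil: "bilinear K M N P (\<lambda>a b. tensor_lift K P (\<tau> a b) s)"
    by (intro bilinearI lin_lift_body[OF mods(3,4,5)] mods s b2)
      (simp_all add: bilinear_left[OF b1] bilinear_right[OF b1] bilinear_left[OF b2] bilinear_right[OF b2])
  then show "tensor_lift K P (\<lambda>a b. tensor_lift K P (\<tau> a b) s) \<in> linear_maps K (tensor_module K M N) P"
    by (intro tensor_lift_linear mods)
  have bil': "bilinear K M' N' P (\<lambda>c d. tensor_lift K P (\<lambda>a b. \<tau> a b c d) t)"
    if "t \<in> carrier (tensor_module K M N)" for t
    by (intro bilinearI lin_lift_body[OF mods(1,2,5)] mods that b1)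
      (simp_all add: bilinear_left[OF b1] bilinear_right[OF b1] bilinear_left[OF b2] bilinear_right[OF b2])
  show "(\<lambda>t. tensor_lift K P (\<lambda>c d. tensor_lift K P (\<lambda>a b. \<tau> a b c d) t) s)
      \<in> linear_maps K (tensor_module K M N) P"
    by (intro lin_lift_body[OF mods(3,4,5)] mods s bil' tensor_lift_linear b1 module_tensor)
  show "tensor_lift K P (\<lambda>a b. tensor_lift K P (\<tau> a b) s) (pure_tensor K M N x y)
      = tensor_lift K P (\<lambda>c d. tensor_lift K P (\<lambda>a b. \<tau> a b c d) (pure_tensor K M N x y)) s"
    if "x \<in> carrier M" "y \<in> carrier N" for x y
    using that b1 by (simp add: tensor_lift_pure[OF mods(1,2,5)] bil cong: tensor_lift_cong[OF mods(3,4) s])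
qed

section \<open>Sweedler calculus\<close>

text \<open>Only linearity of \<Delta> is asked for, so that the calculus is available on the tensor
  square while its coalgebra laws are still being proved.\<close>

locale comultiplication = module K C
  for K :: "('k, 'r) ring_scheme" (structure) and C :: "('k, 'a, 'm) module_scheme" (structure) +
  fixes \<Delta> :: "'a \<Rightarrow> ('k, 'a, 'a) tensor"
  assumes comult_lin: "\<Delta> \<in> linear_maps K C (tensor_module K C C)"
begin

abbreviation "sw P x \<beta> \<equiv> tensor_lift K P \<beta> (\<Delta> x)"

lemma comult_closed: "x \<in> carrier C \<Longrightarrow> \<Delta> x \<in> carrier (tensor_module K C C)"
  by (rule linear_maps_closed[OF comult_lin])

lemma sw_cong:
  "\<lbrakk>x \<in> carrier C; \<And>a b. \<lbrakk>a \<in> carrier C; b \<in> carrier C\<rbrakk> \<Longrightarrow> \<beta> a b = \<gamma> a b\<rbrakk> \<Longrightarrow> sw P x \<beta> = sw P x \<gamma>"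
  by (rule tensor_lift_cong[OF module_axioms module_axioms comult_closed])

lemma sw_closed:
  "\<lbrakk>module K P; bilinear K C C P \<beta>; x \<in> carrier C\<rbrakk> \<Longrightarrow> sw P x \<beta> \<in> carrier P"
  by (rule lift_closed[OF module_axioms module_axioms _ _ comult_closed])

lemma lin_comult: "g \<in> linear_maps K Q C \<Longrightarrow> (\<lambda>x. \<Delta> (g x)) \<in> linear_maps K Q (tensor_module K C C)"
  by (rule linear_maps_comp[OF comult_lin])

lemma lin_sw_arg:
  "\<lbrakk>module K P; bilinear K C C P \<beta>; g \<in> linear_maps K Q C\<rbrakk> \<Longrightarrow> (\<lambda>x. sw P (g x) \<beta>) \<in> linear_maps K Q P"
  by (rule lin_lift_arg[OF module_axioms module_axioms _ _ lin_comult])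

lemma lin_sw_body:
  "\<lbrakk>module K P; module K Q; x \<in> carrier C;
    \<And>a b. \<lbrakk>a \<in> carrier C; b \<in> carrier C\<rbrakk> \<Longrightarrow> (\<lambda>z. \<beta> z a b) \<in> linear_maps K Q P;
    \<And>z. z \<in> carrier Q \<Longrightarrow> bilinear K C C P (\<beta> z)\<rbrakk>
    \<Longrightarrow> (\<lambda>z. sw P x (\<beta> z)) \<in> linear_maps K Q P"
  by (rule lin_lift_body[OF module_axioms module_axioms _ _ comult_closed])

lemma linear_sw:
  "\<lbrakk>module K P; module K Q; h \<in> linear_maps K P Q; bilinear K C C P \<beta>; x \<in> carrier C\<rbrakk>
    \<Longrightarrow> h (sw P x \<beta>) = sw Q x (\<lambda>a b. h (\<beta> a b))"
  by (rule linear_lift[OF module_axioms module_axioms _ _ _ _ comult_closed])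

text \<open>Repeated introduction with these rules shows that a nested Sweedler expression is linear
  in each of its variables; the side conditions of the later rewriting steps are discharged in this
  way.\<close>

lemmas lin_rules = lin_id lin_pure_left lin_pure_right pure_closed lin_sw_arg lin_sw_body sw_closed
  module_axioms module_tensor

lemma sw_fubini:
  assumes "module K P" "x \<in> carrier C" "y \<in> carrier C"
    and "\<And>c d. \<lbrakk>c \<in> carrier C; d \<in> carrier C\<rbrakk> \<Longrightarrow> bilinear K C C P (\<lambda>a b. \<tau> a b c d)"
    and "\<And>a b. \<lbrakk>a \<in> carrier C; b \<in> carrier C\<rbrakk> \<Longrightarrow> bilinear K C C P (\<lambda>c d. \<tau> a b c d)"
  shows "sw P x (\<lambda>a b. sw P y (\<lambda>c d. \<tau> a b c d)) = sw P y (\<lambda>c d. sw P x (\<lambda>a b. \<tau> a b c d))"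
  using assms by (intro lift_fubini[OF module_axioms module_axioms module_axioms module_axioms] comult_closed)

end

text \<open>Both laws are required for the universal integrand, the pure tensor;
  \<open>coassoc_sw\<close> and \<open>cocomm_sw\<close> carry them over to all multilinear
  integrands.\<close>

locale cocommutative_comult = comultiplication K C \<Delta>
  for K :: "('k, 'r) ring_scheme" (structure) and C :: "('k, 'a, 'm) module_scheme" (structure) and \<Delta> +
  assumes coassoc_tensor: "x \<in> carrier C \<Longrightarrow>
      tensor_lift K (tensor_module K C (tensor_module K C C)) (\<lambda>a b.
        tensor_lift K (tensor_module K C (tensor_module K C C)) (\<lambda>c d.
          pure_tensor K C (tensor_module K C C) c (pure_tensor K C C d b)) (\<Delta> a)) (\<Delta> x)
      = tensor_lift K (tensor_module K C (tensor_module K C C)) (\<lambda>a b.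
        tensor_lift K (tensor_module K C (tensor_module K C C)) (\<lambda>c d.
          pure_tensor K C (tensor_module K C C) a (pure_tensor K C C c d)) (\<Delta> b)) (\<Delta> x)"
    and cocomm_tensor: "x \<in> carrier C \<Longrightarrow>
      tensor_lift K (tensor_module K C C) (\<lambda>a b. pure_tensor K C C b a) (\<Delta> x) = \<Delta> x"
begin

text \<open>A trilinear map factors through a linear map \<open>?\<Phi>\<close> on the triple tensor
  product. It is pulled out of both sums, the law for pure tensors is applied, and it is pushed back
  in.\<close>

lemma coassoc_sw:
  assumes P: "module K P" and x: "x \<in> carrier C"
    and b1: "\<And>c. c \<in> carrier C \<Longrightarrow> bilinear K C C P (\<lambda>a b. \<tau> a b c)"
    and b2: "\<And>a. a \<in> carrier C \<Longrightarrow> bilinear K C C P (\<tau> a)"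
  shows "sw P x (\<lambda>p c. sw P p (\<lambda>a b. \<tau> a b c)) = sw P x (\<lambda>a q. sw P q (\<lambda>b c. \<tau> a b c))"
proof -
  note C = module_axioms
  let ?CC = "tensor_module K C C"
  let ?T = "tensor_module K C ?CC"
  let ?p = "\<lambda>a b c. pure_tensor K C ?CC a (pure_tensor K C C b c)"
  let ?\<Phi> = "tensor_lift K P (\<lambda>a. tensor_lift K P (\<tau> a))"
  note rules = bilinearI lin_rules P
  have CC: "module K ?CC" and T: "module K ?T" by (intro rules)+
  have bil: "bilinear K C ?CC P (\<lambda>a. tensor_lift K P (\<tau> a))"
    by (intro bilinearI lin_lift_body[OF C C] tensor_lift_linear C P b2)
      (simp_all add: bilinear_left[OF b1] bilinear_right[OF b1] bilinear_left[OF b2] bilinear_right[OF b2])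
  have \<Phi>: "?\<Phi> \<in> linear_maps K ?T P"
    by (intro tensor_lift_linear C CC P bil)
  have pure: "\<tau> a b c = ?\<Phi> (?p a b c)"
    if "a \<in> carrier C" "b \<in> carrier C" "c \<in> carrier C" for a b c
    using that b2 by (simp add: tensor_lift_pure[OF C CC P bil] tensor_lift_pure[OF C C P] pure_closed C)
  have "sw P x (\<lambda>p c. sw P p (\<lambda>a b. \<tau> a b c)) = sw P x (\<lambda>p c. sw P p (\<lambda>a b. ?\<Phi> (?p a b c)))"
    by (intro sw_cong x pure)
  also have "\<dots> = sw P x (\<lambda>p c. ?\<Phi> (sw ?T p (\<lambda>a b. ?p a b c)))"
    by (intro sw_cong[OF x] linear_sw[symmetric] \<Phi> rules)
  also have "\<dots> = ?\<Phi> (sw ?T x (\<lambda>p c. sw ?T p (\<lambda>a b. ?p a b c)))"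
    by (intro linear_sw[symmetric] \<Phi> rules x)
  also have "sw ?T x (\<lambda>p c. sw ?T p (\<lambda>a b. ?p a b c)) = sw ?T x (\<lambda>a q. sw ?T q (\<lambda>b c. ?p a b c))"
    by (rule coassoc_tensor[OF x])
  also have "?\<Phi> \<dots> = sw P x (\<lambda>a q. ?\<Phi> (sw ?T q (\<lambda>b c. ?p a b c)))"
    by (intro linear_sw \<Phi> rules x)
  also have "\<dots> = sw P x (\<lambda>a q. sw P q (\<lambda>b c. ?\<Phi> (?p a b c)))"
    by (intro sw_cong[OF x] linear_sw \<Phi> rules)
  also have "\<dots> = sw P x (\<lambda>a q. sw P q (\<lambda>b c. \<tau> a b c))"
    by (intro sw_cong x pure[symmetric])
  finally show ?thesis .
qed

lemma cocomm_sw: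
  assumes P: "module K P" and x: "x \<in> carrier C" and b: "bilinear K C C P \<beta>"
  shows "sw P x (\<lambda>p q. \<beta> q p) = sw P x \<beta>"
proof -
  note C = module_axioms
  let ?CC = "tensor_module K C C"
  note rules = bilinearI lin_rules P
  have \<Phi>: "tensor_lift K P \<beta> \<in> linear_maps K ?CC P"
    by (intro tensor_lift_linear C P b)
  have "sw P x (\<lambda>p q. \<beta> q p) = sw P x (\<lambda>p q. tensor_lift K P \<beta> (pure_tensor K C C q p))"
    by (intro sw_cong x tensor_lift_pure[OF C C P b, symmetric])
  also have "\<dots> = tensor_lift K P \<beta> (sw ?CC x (\<lambda>p q. pure_tensor K C C q p))"
    by (intro linear_sw[symmetric] \<Phi> rules x)
  also have "sw ?CC x (\<lambda>p q. pure_tensor K C C q p) = \<Delta> x"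
    by (rule cocomm_tensor[OF x])
  finally show ?thesis .
qed

text \<open>Rebracketing makes the first two legs come from one comultiplication, where they can be
  flipped; then the bracketing is restored.\<close>

lemma sw_swap_first:
  assumes P: "module K P" and x: "x \<in> carrier C"
    and b1: "\<And>c. c \<in> carrier C \<Longrightarrow> bilinear K C C P (\<lambda>a b. \<tau> a b c)"
    and b2: "\<And>a. a \<in> carrier C \<Longrightarrow> bilinear K C C P (\<tau> a)"
  shows "sw P x (\<lambda>a q. sw P q (\<lambda>b c. \<tau> a b c)) = sw P x (\<lambda>a q. sw P q (\<lambda>b c. \<tau> b a c))"
proof -
  have "sw P x (\<lambda>a q. sw P q (\<lambda>b c. \<tau> a b c)) = sw P x (\<lambda>p c. sw P p (\<lambda>a b. \<tau> a b c))"
    by (intro coassoc_sw[symmetric] P x b1 b2)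
  also have "\<dots> = sw P x (\<lambda>p c. sw P p (\<lambda>a b. \<tau> b a c))"
    by (intro sw_cong x cocomm_sw[symmetric] P b1)
  also have "\<dots> = sw P x (\<lambda>a q. sw P q (\<lambda>b c. \<tau> b a c))"
    by (intro coassoc_sw P x bilinearI)
      (simp_all add: bilinear_left[OF b1] bilinear_right[OF b1] bilinear_left[OF b2] bilinear_right[OF b2])
  finally show ?thesis .
qed

text \<open>In the right-nested bracketing of four legs, the second and third are the first two of
  an inner triple, so \<open>sw_swap_first\<close> applies to them. This is the form in which
  cocommutativity is mostly used.\<close>

lemma sw_swap_middle:
  assumes P: "module K P" and x: "x \<in> carrier C"
    and l1: "\<And>b c d. \<lbrakk>b \<in> carrier C; c \<in> carrier C; d \<in> carrier C\<rbrakk> \<Longrightarrow> (\<lambda>a. \<tau> a b c d) \<in> linear_maps K C P"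
    and l2: "\<And>a c d. \<lbrakk>a \<in> carrier C; c \<in> carrier C; d \<in> carrier C\<rbrakk> \<Longrightarrow> (\<lambda>b. \<tau> a b c d) \<in> linear_maps K C P"
    and l3: "\<And>a b d. \<lbrakk>a \<in> carrier C; b \<in> carrier C; d \<in> carrier C\<rbrakk> \<Longrightarrow> (\<lambda>c. \<tau> a b c d) \<in> linear_maps K C P"
    and l4: "\<And>a b c. \<lbrakk>a \<in> carrier C; b \<in> carrier C; c \<in> carrier C\<rbrakk> \<Longrightarrow> (\<lambda>d. \<tau> a b c d) \<in> linear_maps K C P"
  shows "sw P x (\<lambda>p q. sw P p (\<lambda>a b. sw P q (\<lambda>c d. \<tau> a b c d)))
    = sw P x (\<lambda>p q. sw P p (\<lambda>a c. sw P q (\<lambda>b d. \<tau> a b c d)))"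
proof -
  note rules = bilinearI lin_rules l1 l2 l3 l4 P
  have "sw P x (\<lambda>p q. sw P p (\<lambda>a b. sw P q (\<lambda>c d. \<tau> a b c d)))
      = sw P x (\<lambda>a q. sw P q (\<lambda>b r. sw P r (\<lambda>c d. \<tau> a b c d)))"
    by (intro coassoc_sw rules x)
  also have "\<dots> = sw P x (\<lambda>a q. sw P q (\<lambda>c r. sw P r (\<lambda>b d. \<tau> a b c d)))"
    by (intro sw_cong[OF x] sw_swap_first rules)
  also have "\<dots> = sw P x (\<lambda>p q. sw P p (\<lambda>a c. sw P q (\<lambda>b d. \<tau> a b c d)))"
    by (intro coassoc_sw[symmetric] rules x)
  finally show ?thesis .
qed

end

section \<open>Yang--Baxter operators from self-distributive operations\<close>

text \<open>A self-distributive operation transported to coalgebras: an argument that occurs twice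
  is duplicated by \<Delta>. For group-like \<open>w\<close>, meaning
  \<open>\<Delta> w = w \<otimes> w\<close>, the last law reads \<open>(u \<triangleleft> w)
  \<triangleleft> (v \<triangleleft> w) = (u \<triangleleft> v) \<triangleleft> w\<close>.\<close>

locale linear_rack = cocommutative_comult K C \<Delta>
  for K :: "('k, 'r) ring_scheme" (structure) and C :: "('k, 'a, 'm) module_scheme" (structure) and \<Delta> +
  fixes rack :: "'a \<Rightarrow> 'a \<Rightarrow> 'a"  (infixl \<open>\<triangleleft>\<close> 75)
  assumes rack_bilinear: "bilinear K C C C (\<triangleleft>)"
    and comult_rack: "\<lbrakk>u \<in> carrier C; v \<in> carrier C\<rbrakk> \<Longrightarrow>
      \<Delta> (u \<triangleleft> v) = tensor_lift K (tensor_module K C C) (\<lambda>u1 u2.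
        tensor_lift K (tensor_module K C C) (\<lambda>v1 v2. pure_tensor K C C (u1 \<triangleleft> v1) (u2 \<triangleleft> v2)) (\<Delta> v)) (\<Delta> u)"
    and self_distributive: "\<lbrakk>u \<in> carrier C; v \<in> carrier C; w \<in> carrier C\<rbrakk> \<Longrightarrow>
      tensor_lift K C (\<lambda>w1 w2. (u \<triangleleft> w1) \<triangleleft> (v \<triangleleft> w2)) (\<Delta> w) = (u \<triangleleft> v) \<triangleleft> w"
begin

abbreviation "V2 \<equiv> tensor_module K C C"
abbreviation "V3 \<equiv> tensor_module K V2 C"
abbreviation "p3 a b c \<equiv> pure_tensor K V2 C (pure_tensor K C C a b) c"

lemmas rack_rules = lin_rules lin_bilinear_left[OF rack_bilinear] lin_bilinear_right[OF rack_bilinear]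
  bilinear_closed[OF rack_bilinear]

lemma sw_rack:
  assumes P: "module K P" and "u \<in> carrier C" "v \<in> carrier C" and b: "bilinear K C C P \<beta>"
  shows "sw P (u \<triangleleft> v) \<beta> = sw P u (\<lambda>u1 u2. sw P v (\<lambda>v1 v2. \<beta> (u1 \<triangleleft> v1) (u2 \<triangleleft> v2)))"
proof -
  note C = module_axioms
  note rules = bilinearI rack_rules P
  have \<Phi>: "tensor_lift K P \<beta> \<in> linear_maps K V2 P"
    by (intro tensor_lift_linear C P b)
  have "sw P (u \<triangleleft> v) \<beta>
      = sw P u (\<lambda>u1 u2. tensor_lift K P \<beta> (sw V2 v (\<lambda>v1 v2. pure_tensor K C C (u1 \<triangleleft> v1) (u2 \<triangleleft> v2))))"
    unfolding comult_rack[OF assms(2,3)] by (intro linear_sw \<Phi> rules assms(2,3))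
  also have "\<dots> = sw P u (\<lambda>u1 u2. sw P v (\<lambda>v1 v2. tensor_lift K P \<beta> (pure_tensor K C C (u1 \<triangleleft> v1) (u2 \<triangleleft> v2))))"
    by (intro sw_cong[OF assms(2)] linear_sw \<Phi> rules assms(3))
  also have "\<dots> = sw P u (\<lambda>u1 u2. sw P v (\<lambda>v1 v2. \<beta> (u1 \<triangleleft> v1) (u2 \<triangleleft> v2)))"
    by (intro sw_cong[OF assms(2)] sw_cong[OF assms(3)] tensor_lift_pure b rules)
  finally show ?thesis .
qed

section \<open>The operator \<open>R\<close> and its extensions to three tensor factors\<close>

abbreviation "R \<equiv> tensor_lift K V2 (\<lambda>u v. sw V2 v (\<lambda>v1 v2. pure_tensor K C C v1 (u \<triangleleft> v2)))"

lemma R_bilinear: "bilinear K C C V2 (\<lambda>u v. sw V2 v (\<lambda>v1 v2. pure_tensor K C C v1 (u \<triangleleft> v2)))"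
  by (intro bilinearI rack_rules)

lemma R_linear: "R \<in> linear_maps K V2 V2"
  by (intro tensor_lift_linear R_bilinear rack_rules)

lemma R_pure: "\<lbrakk>u \<in> carrier C; v \<in> carrier C\<rbrakk>
    \<Longrightarrow> R (pure_tensor K C C u v) = sw V2 v (\<lambda>v1 v2. pure_tensor K C C v1 (u \<triangleleft> v2))"
  by (intro tensor_lift_pure R_bilinear rack_rules)

abbreviation "R12 \<equiv> tensor_map K V2 C R id"
abbreviation "R23 \<equiv> tensor_assoc_inv K C C C \<circ> tensor_map K C V2 id R \<circ> tensor_assoc K C C C"

lemma R12_linear: "R12 \<in> linear_maps K V3 V3"
  and R12_pure: "\<lbrakk>u \<in> carrier C; v \<in> carrier C; w \<in> carrier C\<rbrakk>
    \<Longrightarrow> R12 (p3 u v w) = sw V3 v (\<lambda>v1 v2. p3 v1 (u \<triangleleft> v2) w)"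
proof -
  note C = module_axioms
  have V2: "module K V2" by (intro module_tensor C)
  have b: "bilinear K V2 C V3 (\<lambda>t w. pure_tensor K V2 C (R t) (id w))"
    unfolding id_apply
    by (intro bilinearI lin_pure_left lin_pure_right V2 C lin_id R_linear linear_maps_closed[OF R_linear])
  show "R12 \<in> linear_maps K V3 V3"
    unfolding tensor_map_def by (intro tensor_lift_linear V2 C module_tensor b)
  assume u: "u \<in> carrier C" and v: "v \<in> carrier C" and w: "w \<in> carrier C"
  have "R12 (p3 u v w) = pure_tensor K V2 C (R (pure_tensor K C C u v)) w"
    unfolding tensor_map_def
    by (subst tensor_lift_pure[OF V2 C module_tensor[OF V2 C] b _ w]) (simp_all add: pure_closed C u v)
  also have "\<dots> = sw V3 v (\<lambda>v1 v2. p3 v1 (u \<triangleleft> v2) w)"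
    unfolding R_pure[OF u v] by (intro linear_sw bilinearI rack_rules u v w)
  finally show "R12 (p3 u v w) = sw V3 v (\<lambda>v1 v2. p3 v1 (u \<triangleleft> v2) w)" .
qed

lemma assoc_linear: "tensor_assoc K C C C \<in> linear_maps K V3 (tensor_module K C V2)"
  and assoc_pure: "\<lbrakk>u \<in> carrier C; v \<in> carrier C; w \<in> carrier C\<rbrakk>
    \<Longrightarrow> tensor_assoc K C C C (p3 u v w) = pure_tensor K C V2 u (pure_tensor K C C v w)"
proof -
  note C = module_axioms
  have V2: "module K V2" and V: "module K (tensor_module K C V2)" by (intro module_tensor C)+
  have b: "bilinear K C C (tensor_module K C V2) (\<lambda>x y. pure_tensor K C V2 x (pure_tensor K C C y z))"
    if "z \<in> carrier C" for z
    by (intro bilinearI rack_rules that)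
  have b': "bilinear K V2 C (tensor_module K C V2) (\<lambda>u z. tensor_lift K (tensor_module K C V2)
      (\<lambda>x y. pure_tensor K C V2 x (pure_tensor K C C y z)) u)"
    by (intro bilinearI tensor_lift_linear lin_lift_body[OF C C] rack_rules)
  show "tensor_assoc K C C C \<in> linear_maps K V3 (tensor_module K C V2)"
    unfolding tensor_assoc_def Let_def by (intro tensor_lift_linear V2 C V b')
  assume u: "u \<in> carrier C" and v: "v \<in> carrier C" and w: "w \<in> carrier C"
  show "tensor_assoc K C C C (p3 u v w) = pure_tensor K C V2 u (pure_tensor K C C v w)"
    unfolding tensor_assoc_def Let_def
    by (simp add: tensor_lift_pure[OF V2 C V b' _ w] tensor_lift_pure[OF C C V b[OF w] u v] pure_closed C u v w)
qed

lemma assoc_inv_linear: "tensor_assoc_inv K C C C \<in> linear_maps K (tensor_module K C V2) V3"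
  and assoc_inv_pure: "\<lbrakk>u \<in> carrier C; v \<in> carrier C; w \<in> carrier C\<rbrakk>
    \<Longrightarrow> tensor_assoc_inv K C C C (pure_tensor K C V2 u (pure_tensor K C C v w)) = p3 u v w"
proof -
  note C = module_axioms
  have V2: "module K V2" and V: "module K V3" by (intro module_tensor C)+
  have b: "bilinear K C C V3 (\<lambda>y z. p3 x y z)" if "x \<in> carrier C" for x
    by (intro bilinearI rack_rules that)
  have b': "bilinear K C V2 V3 (\<lambda>x v. tensor_lift K V3 (\<lambda>y z. p3 x y z) v)"
    by (intro bilinearI tensor_lift_linear lin_lift_body[OF C C] rack_rules)
  show "tensor_assoc_inv K C C C \<in> linear_maps K (tensor_module K C V2) V3"
    unfolding tensor_assoc_inv_def Let_def by (intro tensor_lift_linear V2 C V b')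
  assume u: "u \<in> carrier C" and v: "v \<in> carrier C" and w: "w \<in> carrier C"
  show "tensor_assoc_inv K C C C (pure_tensor K C V2 u (pure_tensor K C C v w)) = p3 u v w"
    unfolding tensor_assoc_inv_def Let_def
    by (simp add: tensor_lift_pure[OF C V2 V b' u] tensor_lift_pure[OF C C V b[OF u] v w] pure_closed C u v w)
qed

lemma R23_linear: "R23 \<in> linear_maps K V3 V3"
  and R23_pure: "\<lbrakk>u \<in> carrier C; v \<in> carrier C; w \<in> carrier C\<rbrakk>
    \<Longrightarrow> R23 (p3 u v w) = sw V3 w (\<lambda>w1 w2. p3 u w1 (v \<triangleleft> w2))"
proof -
  note C = module_axioms
  have V2: "module K V2" and V: "module K (tensor_module K C V2)" by (intro module_tensor C)+
  have b: "bilinear K C V2 (tensor_module K C V2) (\<lambda>u t. pure_tensor K C V2 (id u) (R t))"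
    unfolding id_apply
    by (intro bilinearI lin_pure_left lin_pure_right V2 C lin_id R_linear linear_maps_closed[OF R_linear])
  have map: "tensor_map K C V2 id R \<in> linear_maps K (tensor_module K C V2) (tensor_module K C V2)"
    unfolding tensor_map_def by (intro tensor_lift_linear V2 C V b)
  show "R23 \<in> linear_maps K V3 V3"
    unfolding comp_def by (intro linear_maps_comp[OF assoc_inv_linear] linear_maps_comp[OF map] assoc_linear)
  assume u: "u \<in> carrier C" and v: "v \<in> carrier C" and w: "w \<in> carrier C"
  have "R23 (p3 u v w) = tensor_assoc_inv K C C C (pure_tensor K C V2 u (R (pure_tensor K C C v w)))"
    unfolding tensor_map_def comp_def assoc_pure[OF u v w]
    by (subst tensor_lift_pure[OF C V2 V b u]) (simp_all add: pure_closed C v w)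
  also have "\<dots> = tensor_assoc_inv K C C C
      (sw (tensor_module K C V2) w (\<lambda>w1 w2. pure_tensor K C V2 u (pure_tensor K C C w1 (v \<triangleleft> w2))))"
    unfolding R_pure[OF v w]
    by (intro arg_cong[of _ _ "tensor_assoc_inv K C C C"] linear_sw bilinearI rack_rules u v w)
  also have "\<dots> = sw V3 w (\<lambda>w1 w2. tensor_assoc_inv K C C C
      (pure_tensor K C V2 u (pure_tensor K C C w1 (v \<triangleleft> w2))))"
    by (intro linear_sw assoc_inv_linear bilinearI rack_rules u v w)
  also have "\<dots> = sw V3 w (\<lambda>w1 w2. p3 u w1 (v \<triangleleft> w2))"
    by (intro sw_cong assoc_inv_pure rack_rules u v w)
  finally show "R23 (p3 u v w) = sw V3 w (\<lambda>w1 w2. p3 u w1 (v \<triangleleft> w2))" .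
qed

lemma yang_baxter_pure:
  assumes u: "u \<in> carrier C" and v: "v \<in> carrier C" and w: "w \<in> carrier C"
  shows "R12 (R23 (R12 (p3 u v w))) = R23 (R12 (R23 (p3 u v w)))"
proof -
  note rules = bilinearI rack_rules u v w
  note R12R23 = linear_maps_comp[OF R12_linear R23_linear]
  have "R12 (R23 (R12 (p3 u v w))) = sw V3 v (\<lambda>v1 v2. R12 (R23 (p3 v1 (u \<triangleleft> v2) w)))"
    unfolding R12_pure[OF u v w] by (intro linear_sw[OF _ _ R12R23] rules)
  also have "\<dots> = sw V3 v (\<lambda>v1 v2. R12 (sw V3 w (\<lambda>w1 w2. p3 v1 w1 (u \<triangleleft> v2 \<triangleleft> w2))))"
    by (intro sw_cong[OF v] arg_cong[of _ _ R12] R23_pure rules)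
  also have "\<dots> = sw V3 v (\<lambda>v1 v2. sw V3 w (\<lambda>w1 w2. R12 (p3 v1 w1 (u \<triangleleft> v2 \<triangleleft> w2))))"
    by (intro sw_cong[OF v] linear_sw R12_linear rules)
  also have "\<dots> = sw V3 v (\<lambda>v1 v2. sw V3 w (\<lambda>w1 w2. sw V3 w1 (\<lambda>a c. p3 a (v1 \<triangleleft> c) (u \<triangleleft> v2 \<triangleleft> w2))))"
    by (intro sw_cong[OF v] sw_cong[OF w] R12_pure rules)
  finally have lhs: "R12 (R23 (R12 (p3 u v w))) =
      sw V3 v (\<lambda>v1 v2. sw V3 w (\<lambda>w1 w2. sw V3 w1 (\<lambda>a c. p3 a (v1 \<triangleleft> c) (u \<triangleleft> v2 \<triangleleft> w2))))" .
  note R23R12 = linear_maps_comp[OF R23_linear R12_linear]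
  have "R23 (R12 (R23 (p3 u v w))) = sw V3 w (\<lambda>w1 w2. R23 (R12 (p3 u w1 (v \<triangleleft> w2))))"
    unfolding R23_pure[OF u v w] by (intro linear_sw[OF _ _ R23R12] rules)
  also have "\<dots> = sw V3 w (\<lambda>w1 w2. R23 (sw V3 w1 (\<lambda>a b. p3 a (u \<triangleleft> b) (v \<triangleleft> w2))))"
    by (intro sw_cong[OF w] arg_cong[of _ _ R23] R12_pure rules)
  also have "\<dots> = sw V3 w (\<lambda>w1 w2. sw V3 w1 (\<lambda>a b. R23 (p3 a (u \<triangleleft> b) (v \<triangleleft> w2))))"
    by (intro sw_cong[OF w] linear_sw R23_linear rules)
  also have "\<dots> = sw V3 w (\<lambda>w1 w2. sw V3 w1 (\<lambda>a b. sw V3 (v \<triangleleft> w2) (\<lambda>c d. p3 a c (u \<triangleleft> b \<triangleleft> d))))"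
    by (intro sw_cong[OF w] sw_cong R23_pure rules)
  \<comment> \<open>Comultiplying \<open>v \<triangleleft> w2\<close> splits both \<open>v\<close>
    and \<open>w2\<close>, so that \<open>w\<close> now has the four legs \<open>a\<close>,
    \<open>b\<close>, \<open>c\<close>, \<open>d\<close>.\<close>
  also have "\<dots> = sw V3 w (\<lambda>w1 w2. sw V3 w1 (\<lambda>a b. sw V3 v (\<lambda>v1 v2. sw V3 w2 (\<lambda>c d.
      p3 a (v1 \<triangleleft> c) (u \<triangleleft> b \<triangleleft> (v2 \<triangleleft> d))))))"
    by (intro sw_cong[OF w] sw_cong sw_rack rules)
  \<comment> \<open>Two exchanges move the sum over \<open>v\<close> outermost, to match
    \<open>lhs\<close>.\<close>
  also have "\<dots> = sw V3 w (\<lambda>w1 w2. sw V3 v (\<lambda>v1 v2. sw V3 w1 (\<lambda>a b. sw V3 w2 (\<lambda>c d.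
      p3 a (v1 \<triangleleft> c) (u \<triangleleft> b \<triangleleft> (v2 \<triangleleft> d))))))"
    by (intro sw_cong[OF w] sw_fubini rules)
  also have "\<dots> = sw V3 v (\<lambda>v1 v2. sw V3 w (\<lambda>w1 w2. sw V3 w1 (\<lambda>a b. sw V3 w2 (\<lambda>c d.
      p3 a (v1 \<triangleleft> c) (u \<triangleleft> b \<triangleleft> (v2 \<triangleleft> d))))))"
    by (intro sw_fubini rules)
  \<comment> \<open>Exchanging the middle legs of \<open>w\<close> makes \<open>b\<close> and
    \<open>d\<close> the two legs of \<open>w2\<close>.\<close>
  also have "\<dots> = sw V3 v (\<lambda>v1 v2. sw V3 w (\<lambda>w1 w2. sw V3 w1 (\<lambda>a c. sw V3 w2 (\<lambda>b d.
      p3 a (v1 \<triangleleft> c) (u \<triangleleft> b \<triangleleft> (v2 \<triangleleft> d))))))"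
    by (intro sw_cong[OF v] sw_swap_middle rules)
  \<comment> \<open>\<open>b\<close> and \<open>d\<close> occur in the third factor only, so their
    sum moves inside it, ready for self-distributivity.\<close>
  also have "\<dots> = sw V3 v (\<lambda>v1 v2. sw V3 w (\<lambda>w1 w2. sw V3 w1 (\<lambda>a c.
      p3 a (v1 \<triangleleft> c) (sw C w2 (\<lambda>b d. u \<triangleleft> b \<triangleleft> (v2 \<triangleleft> d))))))"
    by (intro sw_cong[OF v] sw_cong[OF w] sw_cong linear_sw[symmetric] rules)
  also have "\<dots> = sw V3 v (\<lambda>v1 v2. sw V3 w (\<lambda>w1 w2. sw V3 w1 (\<lambda>a c.
      p3 a (v1 \<triangleleft> c) (u \<triangleleft> v2 \<triangleleft> w2))))"
    by (intro sw_cong[OF v] sw_cong[OF w] sw_cong arg_cong[of _ _ "pure_tensor K V2 C _"] self_distributive rules)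
  finally show ?thesis unfolding lhs ..
qed

theorem yang_baxter: "yang_baxter_solution K C R"
proof -
  note C = module_axioms
  have V2: "module K V2" and V3: "module K V3" by (intro module_tensor C)+
  have L: "(\<lambda>t. R12 (R23 (R12 t))) \<in> linear_maps K V3 V3" "(\<lambda>t. R23 (R12 (R23 t))) \<in> linear_maps K V3 V3"
    by (intro linear_maps_comp[OF R12_linear] linear_maps_comp[OF R23_linear] R12_linear R23_linear)+
  have pure: "(\<lambda>s. pure_tensor K V2 C s w) \<in> linear_maps K V2 V3" if "w \<in> carrier C" for w
    by (intro lin_pure_left V2 C lin_id that)
  have "R12 (R23 (R12 t)) = R23 (R12 (R23 t))" if "t \<in> carrier V3" for t
  proof (rule tensor_ext[OF V2 C V3 L _ that])
    fix s w assume s: "s \<in> carrier V2" and w: "w \<in> carrier C"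
    \<comment> \<open>The first slot \<open>s\<close> is an arbitrary element of \<open>V2\<close>;
      a second use of \<open>tensor_ext\<close>, now in \<open>s\<close>, reduces it to a pure
      tensor.\<close>
    show "R12 (R23 (R12 (pure_tensor K V2 C s w))) = R23 (R12 (R23 (pure_tensor K V2 C s w)))"
      by (rule tensor_ext[OF C C V3 linear_maps_comp[OF L(1) pure[OF w]] linear_maps_comp[OF L(2) pure[OF w]] _ s])
        (rule yang_baxter_pure[OF _ _ w])
  qed
  then show ?thesis
    using R_linear by (simp add: yang_baxter_solution_def Let_def)
qed

end

section \<open>Hopf algebras and the adjoint action\<close>

sublocale coalgebra \<subseteq> comultiplication K C "comult C"
  by unfold_locales (rule comult_linear)

section \<open>Coassociativity and the counit laws as rules for Sweedler expressions\<close>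

context coalgebra
begin

text \<open>Unpacks the associator and the tensor maps of the coalgebra axiom into the form required
  by \<open>cocommutative_comult\<close>.\<close>

lemma coassoc_pure:
  assumes x: "x \<in> carrier C"
  defines "T \<equiv> tensor_module K C (tensor_module K C C)"
  shows "sw T x (\<lambda>p c. sw T p (\<lambda>a b. pure_tensor K C (tensor_module K C C) a (pure_tensor K C C b c)))
    = sw T x (\<lambda>a q. sw T q (\<lambda>b c. pure_tensor K C (tensor_module K C C) a (pure_tensor K C C b c)))"
    (is "?L = ?R")
proof -
  let ?V2 = "tensor_module K C C"
  let ?V3 = "tensor_module K ?V2 C"
  let ?A = "\<lambda>u z. tensor_lift K T (\<lambda>x y. pure_tensor K C ?V2 x (pure_tensor K C C y z)) u"
  note C = module_axioms
  have V2: "module K ?V2" and V3: "module K ?V3" and T: "module K T"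
    unfolding T_def by (intro module_tensor C)+
  have b: "bilinear K C C T (\<lambda>x y. pure_tensor K C ?V2 x (pure_tensor K C C y z))"
    if "z \<in> carrier C" for z
    unfolding T_def by (intro bilinearI lin_rules that)
  have bA: "bilinear K ?V2 C T ?A"
    unfolding T_def by (intro bilinearI tensor_lift_linear lin_lift_body[OF C C] lin_rules)
  have A: "tensor_lift K T ?A \<in> linear_maps K ?V3 T"
    by (intro tensor_lift_linear V2 C T bA)
  have "tensor_map K ?V2 C (comult C) id (comult C x) = sw ?V3 x (\<lambda>p c. pure_tensor K ?V2 C (comult C p) c)"
    by (simp add: tensor_map_def)
  then have "tensor_assoc K C C C (tensor_map K ?V2 C (comult C) id (comult C x))
      = tensor_lift K T ?A (sw ?V3 x (\<lambda>p c. pure_tensor K ?V2 C (comult C p) c))"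
    by (simp add: tensor_assoc_def T_def Let_def)
  also have "\<dots> = sw T x (\<lambda>p c. tensor_lift K T ?A (pure_tensor K ?V2 C (comult C p) c))"
    by (intro linear_sw A bilinearI lin_rules V2 V3 T x lin_comult comult_closed)
  also have "\<dots> = ?L"
    by (intro sw_cong x tensor_lift_pure V2 C T bA comult_closed)
  finally have L: "tensor_assoc K C C C (tensor_map K ?V2 C (comult C) id (comult C x)) = ?L" .
  have "tensor_map K C ?V2 id (comult C) (comult C x) = sw T x (\<lambda>a q. pure_tensor K C ?V2 a (comult C q))"
    by (simp add: tensor_map_def T_def)
  \<comment> \<open>\<open>comult C q\<close> is expanded into pure tensors, so that linearity can
    bring its sum to the outside.\<close>
  also have "\<dots> = sw T x (\<lambda>a q. pure_tensor K C ?V2 a (sw ?V2 q (pure_tensor K C C)))"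
    by (intro sw_cong x) (simp_all add: lift_pure_tensor C comult_closed)
  also have "\<dots> = ?R"
    unfolding T_def by (intro sw_cong[OF x] linear_sw bilinearI lin_rules bilinear_pure)
  finally show ?thesis
    using L coassoc[OF x] by simp
qed

lemma counit_closed: "x \<in> carrier C \<Longrightarrow> counit C x \<in> carrier K"
  using counit_add_hom by (auto simp: hom_def)

text \<open>The counit takes values in the ring \<open>K\<close>, which is not packaged as a module;
  it therefore enters the linearity rules through scalar multiples.\<close>

lemma counit_lin: "\<lbrakk>module K P; g \<in> linear_maps K Q C; y \<in> carrier P\<rbrakk>
    \<Longrightarrow> (\<lambda>x. counit C (g x) \<odot>\<^bsub>P\<^esub> y) \<in> linear_maps K Q P"
proof -
  assume P: "module K P" and g: "g \<in> linear_maps K Q C" and y: "y \<in> carrier P"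
  interpret P: module K P by (rule P)
  have "(\<lambda>x. counit C x \<odot>\<^bsub>P\<^esub> y) \<in> linear_maps K C P"
    using counit_add_hom y counit_closed
    by (intro linear_mapsI) (auto simp: hom_def counit_smult P.smult_l_distr P.smult_assoc1)
  then show ?thesis using g by (rule linear_maps_comp)
qed

lemma smult_lin: "\<lbrakk>module K P; a \<in> carrier K; g \<in> linear_maps K Q P\<rbrakk>
    \<Longrightarrow> (\<lambda>x. a \<odot>\<^bsub>P\<^esub> g x) \<in> linear_maps K Q P"
proof -
  assume P: "module K P" and a: "a \<in> carrier K" and g: "g \<in> linear_maps K Q P"
  interpret P: module K P by (rule P)
  have "(\<lambda>x. a \<odot>\<^bsub>P\<^esub> x) \<in> linear_maps K P P"
    using a by (intro linear_mapsI) (auto simp: P.smult_r_distr P.smult_assoc1[symmetric] R.m_comm)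
  then show ?thesis using g by (rule linear_maps_comp)
qed

lemmas counit_rules = counit_lin counit_closed smult_lin module.smult_closed

lemma sw_counit_left:
  assumes P: "module K P" and f: "f \<in> linear_maps K C P" and x: "x \<in> carrier C"
  shows "sw P x (\<lambda>a b. counit C a \<odot>\<^bsub>P\<^esub> f b) = f x"
proof -
  have "f x = f (sw C x (\<lambda>a b. counit C a \<odot>\<^bsub>C\<^esub> b))"
    by (simp add: counit_left x)
  also have "\<dots> = sw P x (\<lambda>a b. f (counit C a \<odot>\<^bsub>C\<^esub> b))"
    by (intro linear_sw P f x bilinearI counit_rules lin_rules)
  also have "\<dots> = sw P x (\<lambda>a b. counit C a \<odot>\<^bsub>P\<^esub> f b)"
    by (intro sw_cong x linear_maps_smult[OF f] counit_closed)
  finally show ?thesis ..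
qed

lemma sw_counit_right:
  assumes P: "module K P" and f: "f \<in> linear_maps K C P" and x: "x \<in> carrier C"
  shows "sw P x (\<lambda>a b. counit C b \<odot>\<^bsub>P\<^esub> f a) = f x"
proof -
  have "f x = f (sw C x (\<lambda>a b. counit C b \<odot>\<^bsub>C\<^esub> a))"
    by (simp add: counit_right x)
  also have "\<dots> = sw P x (\<lambda>a b. f (counit C b \<odot>\<^bsub>C\<^esub> a))"
    by (intro linear_sw P f x bilinearI counit_rules lin_rules)
  also have "\<dots> = sw P x (\<lambda>a b. counit C b \<odot>\<^bsub>P\<^esub> f a)"
    by (intro sw_cong x linear_maps_smult[OF f] counit_closed)
  finally show ?thesis ..
qed

end

section \<open>Multiplicativity of the comultiplication\<close>

context bialgebra
begin

abbreviation hopf_mult (infixl \<open>\<star>\<close> 70)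
  where "x \<star> y \<equiv> x \<otimes>\<^bsub>H\<^esub> y"

lemma mult_bilinear: "bilinear K H H H (\<star>)"
  by (intro bilinearI linear_mapsI)
    (simp_all add: H.l_distr H.r_distr smult_mult_left smult_mult_right)

lemmas mult_rules = lin_bilinear_left[OF mult_bilinear] lin_bilinear_right[OF mult_bilinear] H.m_closed
  H.one_closed

lemma sw_mult:
  assumes P: "module K P" and x: "x \<in> carrier H" and y: "y \<in> carrier H" and b: "bilinear K H H P \<beta>"
  shows "sw P (x \<star> y) \<beta> = sw P x (\<lambda>a b. sw P y (\<lambda>c d. \<beta> (a \<star> c) (b \<star> d)))"
proof -
  let ?T = "tensor_module K H H"
  note rules = bilinearI lin_rules mult_rules lin_bilinear_left[OF b] lin_bilinear_right[OF b]
  have \<Phi>: "tensor_lift K P \<beta> \<in> linear_maps K ?T P"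
    by (intro tensor_lift_linear module_axioms P b)
  have "sw P (x \<star> y) \<beta> = tensor_lift K P \<beta> (sw ?T x (\<lambda>a b. sw ?T y (\<lambda>c d. pure_tensor K H H (a \<star> c) (b \<star> d))))"
    by (simp add: comult_mult x y tensor_mult_def Let_def)
  also have "\<dots> = sw P x (\<lambda>a b. tensor_lift K P \<beta> (sw ?T y (\<lambda>c d. pure_tensor K H H (a \<star> c) (b \<star> d))))"
    by (intro linear_sw \<Phi> P rules x y)
  also have "\<dots> = sw P x (\<lambda>a b. sw P y (\<lambda>c d. tensor_lift K P \<beta> (pure_tensor K H H (a \<star> c) (b \<star> d))))"
    by (intro sw_cong[OF x] linear_sw \<Phi> P rules y)
  also have "\<dots> = sw P x (\<lambda>a b. sw P y (\<lambda>c d. \<beta> (a \<star> c) (b \<star> d)))"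
    by (intro sw_cong[OF x] sw_cong[OF y] tensor_lift_pure P b rules)
  finally show ?thesis .
qed

lemma sw_one:
  assumes P: "module K P" and b: "bilinear K H H P \<beta>"
  shows "sw P \<one>\<^bsub>H\<^esub> \<beta> = \<beta> \<one>\<^bsub>H\<^esub> \<one>\<^bsub>H\<^esub>"
  unfolding comult_one by (intro tensor_lift_pure module_axioms P b H.one_closed)

end

context hopf_algebra
begin

abbreviation "S \<equiv> antipode H"
abbreviation "ad \<equiv> adjoint K H"

lemma antipode_closed: "x \<in> carrier H \<Longrightarrow> S x \<in> carrier H"
  by (rule linear_maps_closed[OF antipode_linear])

lemmas hopf_rules = lin_rules counit_rules mult_rules linear_maps_comp[OF antipode_linear] antipode_closed

text \<open>Cancellation rule: once \<open>S a\<close> stands next to \<open>b\<close> inside a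
  linear expression, both disappear and leave a counit, which \<open>sw_counit_left\<close> or
  \<open>sw_counit_right\<close> then removes.\<close>

lemma sw_antipode_left:
  assumes P: "module K P" and f: "f \<in> linear_maps K H P" and x: "x \<in> carrier H"
  shows "sw P x (\<lambda>a b. f (S a \<star> b)) = counit H x \<odot>\<^bsub>P\<^esub> f \<one>\<^bsub>H\<^esub>"
proof -
  have "sw P x (\<lambda>a b. f (S a \<star> b)) = f (sw H x (\<lambda>a b. S a \<star> b))"
    by (intro linear_sw[symmetric] P f x bilinearI hopf_rules)
  also have "\<dots> = counit H x \<odot>\<^bsub>P\<^esub> f \<one>\<^bsub>H\<^esub>"
    by (simp add: antipode_left x linear_maps_smult[OF f] counit_closed)
  finally show ?thesis .
qed

lemma sw_antipode_right:
  assumes P: "module K P" and f: "f \<in> linear_maps K H P" and x: "x \<in> carrier H"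
  shows "sw P x (\<lambda>a b. f (a \<star> S b)) = counit H x \<odot>\<^bsub>P\<^esub> f \<one>\<^bsub>H\<^esub>"
proof -
  have "sw P x (\<lambda>a b. f (a \<star> S b)) = f (sw H x (\<lambda>a b. a \<star> S b))"
    by (intro linear_sw[symmetric] P f x bilinearI hopf_rules)
  also have "\<dots> = counit H x \<odot>\<^bsub>P\<^esub> f \<one>\<^bsub>H\<^esub>"
    by (simp add: antipode_right x linear_maps_smult[OF f] counit_closed)
  finally show ?thesis .
qed

end

section \<open>Compatibility of the antipode with products and coproducts\<close>

context cocommutative_hopf_algebra
begin

sublocale cocommutative_comult K H "comult H"
proof unfold_locales
  fix x assume x: "x \<in> carrier H"
  show "sw (tensor_module K H H) x (\<lambda>a b. pure_tensor K H H b a) = comult H x"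
    using cocommutative[OF x] by (simp add: tensor_swap_def)
qed (rule coassoc_pure)

text \<open>Uniqueness of convolution inverses: both sides are inverse to the multiplication
  \<open>H \<otimes> H \<rightarrow> H\<close>. Accordingly \<open>?E\<close>, which stands for
  \<open>S y1 S x1 (x2 y2) S (x3 y3)\<close>, is computed by cancelling its last two factors and
  again by cancelling its first ones.\<close>

lemma antipode_mult:
  assumes x: "x \<in> carrier H" and y: "y \<in> carrier H"
  shows "S (x \<star> y) = S y \<star> S x"
proof -
  note rules = bilinearI hopf_rules x y
  let ?E = "sw H x (\<lambda>a x'. sw H y (\<lambda>d y'. S d \<star> S a \<star> sw H (x' \<star> y') (\<lambda>p q. p \<star> S q)))"
  have "?E = sw H x (\<lambda>a x'. sw H y (\<lambda>d y'. counit H y' \<odot>\<^bsub>H\<^esub> (counit H x' \<odot>\<^bsub>H\<^esub> (S d \<star> S a))))"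
    by (intro sw_cong x y)
      (simp add: antipode_right antipode_closed counit_closed counit_mult smult_mult_right
        smult_assoc1[symmetric] R.m_comm)
  also have "\<dots> = sw H x (\<lambda>a x'. counit H x' \<odot>\<^bsub>H\<^esub> (S y \<star> S a))"
    by (intro sw_cong[OF x] sw_counit_right rules)
  also have "\<dots> = S y \<star> S x"
    by (intro sw_counit_right rules)
  finally have E1: "?E = S y \<star> S x" .
  \<comment> \<open>Second computation: the middle product is expanded and the legs of
    \<open>x\<close> and \<open>y\<close> are rebracketed, so that \<open>S a\<close> meets
    \<open>b\<close>; after their cancellation \<open>S d\<close> meets \<open>e\<close>.\<close>
  have "?E = sw H x (\<lambda>a x'. sw H y (\<lambda>d y'. S d \<star> S a \<star>
      sw H x' (\<lambda>b c. sw H y' (\<lambda>e f. (b \<star> e) \<star> S (c \<star> f)))))"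
    by (intro sw_cong[OF x] sw_cong[OF y] arg_cong[of _ _ "(\<star>) _"] sw_mult rules)
  also have "\<dots> = sw H x (\<lambda>a x'. sw H y (\<lambda>d y'.
      sw H x' (\<lambda>b c. S d \<star> S a \<star> sw H y' (\<lambda>e f. (b \<star> e) \<star> S (c \<star> f)))))"
    by (intro sw_cong[OF x] sw_cong[OF y] linear_sw rules)
  also have "\<dots> = sw H x (\<lambda>a x'. sw H x' (\<lambda>b c.
      sw H y (\<lambda>d y'. S d \<star> S a \<star> sw H y' (\<lambda>e f. (b \<star> e) \<star> S (c \<star> f)))))"
    by (intro sw_cong[OF x] sw_fubini rules)
  also have "\<dots> = sw H x (\<lambda>x' c. sw H x' (\<lambda>a b.
      sw H y (\<lambda>d y'. S d \<star> S a \<star> sw H y' (\<lambda>e f. (b \<star> e) \<star> S (c \<star> f)))))"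
    by (intro coassoc_sw[symmetric] rules)
  also have "\<dots> = sw H x (\<lambda>x' c. sw H x' (\<lambda>a b.
      sw H y (\<lambda>d y'. sw H y' (\<lambda>e f. S d \<star> S a \<star> ((b \<star> e) \<star> S (c \<star> f))))))"
    by (intro sw_cong[OF x] sw_cong[OF y] sw_cong linear_sw rules)
  also have "\<dots> = sw H x (\<lambda>x' c. sw H x' (\<lambda>a b.
      sw H y (\<lambda>y' f. sw H y' (\<lambda>d e. S d \<star> S a \<star> ((b \<star> e) \<star> S (c \<star> f))))))"
    by (intro sw_cong[OF x] sw_cong coassoc_sw[symmetric] rules)
  also have "\<dots> = sw H x (\<lambda>x' c. sw H x' (\<lambda>a b.
      sw H y (\<lambda>y' f. sw H y' (\<lambda>d e. S d \<star> ((S a \<star> b) \<star> (e \<star> S (c \<star> f)))))))"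
    by (intro sw_cong[OF x] sw_cong[OF y] sw_cong) (simp_all add: H.m_assoc antipode_closed y)
  also have "\<dots> = sw H x (\<lambda>x' c. counit H x' \<odot>\<^bsub>H\<^esub>
      sw H y (\<lambda>y' f. sw H y' (\<lambda>d e. S d \<star> (\<one>\<^bsub>H\<^esub> \<star> (e \<star> S (c \<star> f))))))"
    by (intro sw_cong[OF x] sw_antipode_left rules)
  also have "\<dots> = sw H y (\<lambda>y' f. sw H y' (\<lambda>d e. S d \<star> (\<one>\<^bsub>H\<^esub> \<star> (e \<star> S (x \<star> f)))))"
    by (intro sw_counit_left rules)
  also have "\<dots> = sw H y (\<lambda>y' f. sw H y' (\<lambda>d e. (S d \<star> e) \<star> S (x \<star> f)))"
    by (intro sw_cong[OF y] sw_cong) (simp_all add: H.m_assoc antipode_closed x)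
  also have "\<dots> = sw H y (\<lambda>y' f. counit H y' \<odot>\<^bsub>H\<^esub> (\<one>\<^bsub>H\<^esub> \<star> S (x \<star> f)))"
    by (intro sw_cong[OF y] sw_antipode_left rules)
  also have "\<dots> = \<one>\<^bsub>H\<^esub> \<star> S (x \<star> y)"
    by (intro sw_counit_left rules)
  finally show ?thesis
    using E1 x y by (simp add: antipode_closed)
qed

text \<open>Again by convolution inverses, now of the comultiplication. \<open>?E\<close> stands for
  \<open>(S x1 \<otimes> S x2) \<Delta>(x3 S x4)\<close>: cancelling inside \<Delta> gives the right
  side, multiplying out \<Delta> and cancelling in each factor gives the left.\<close>

lemma sw_antipode:
  assumes P: "module K P" and x: "x \<in> carrier H" and b: "bilinear K H H P \<beta>"
  shows "sw P (S x) \<beta> = sw P x (\<lambda>a b. \<beta> (S a) (S b))"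
proof -
  note rules = bilinearI hopf_rules P x lin_bilinear_left[OF b] lin_bilinear_right[OF b] bilinear_closed[OF b]
  let ?E = "sw P x (\<lambda>a q. sw P q (\<lambda>c d. sw P a (\<lambda>a1 a2. sw P (c \<star> S d) (\<lambda>y z. \<beta> (S a1 \<star> y) (S a2 \<star> z)))))"
  have "?E = sw P x (\<lambda>a q. counit H q \<odot>\<^bsub>P\<^esub>
      sw P a (\<lambda>a1 a2. sw P \<one>\<^bsub>H\<^esub> (\<lambda>y z. \<beta> (S a1 \<star> y) (S a2 \<star> z))))"
    by (intro sw_cong[OF x] sw_antipode_right rules)
  also have "\<dots> = sw P x (\<lambda>a1 a2. sw P \<one>\<^bsub>H\<^esub> (\<lambda>y z. \<beta> (S a1 \<star> y) (S a2 \<star> z)))"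
    by (intro sw_counit_right rules)
  also have "\<dots> = sw P x (\<lambda>a1 a2. \<beta> (S a1 \<star> \<one>\<^bsub>H\<^esub>) (S a2 \<star> \<one>\<^bsub>H\<^esub>))"
    by (intro sw_cong[OF x] sw_one rules)
  also have "\<dots> = sw P x (\<lambda>a b. \<beta> (S a) (S b))"
    by (intro sw_cong[OF x]) (simp add: antipode_closed)
  finally have E1: "?E = sw P x (\<lambda>a b. \<beta> (S a) (S b))" .
  have "?E = sw P x (\<lambda>r d. sw P r (\<lambda>a c. sw P a (\<lambda>a1 a2.
      sw P (c \<star> S d) (\<lambda>y z. \<beta> (S a1 \<star> y) (S a2 \<star> z)))))"
    by (intro coassoc_sw[symmetric] rules)
  also have "\<dots> = sw P x (\<lambda>r d. sw P r (\<lambda>a c. sw P a (\<lambda>a1 a2. sw P c (\<lambda>c1 c2.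
      sw P (S d) (\<lambda>p q. \<beta> (S a1 \<star> (c1 \<star> p)) (S a2 \<star> (c2 \<star> q)))))))"
    by (intro sw_cong[OF x] sw_cong sw_mult rules)
  \<comment> \<open>Exchanging \<open>a2\<close> with \<open>c1\<close> puts each antipoded leg into
    the same comultiplication as its partner, so that both pairs can cancel.\<close>
  also have "\<dots> = sw P x (\<lambda>r d. sw P r (\<lambda>a c. sw P a (\<lambda>a1 c1. sw P c (\<lambda>a2 c2.
      sw P (S d) (\<lambda>p q. \<beta> (S a1 \<star> (c1 \<star> p)) (S a2 \<star> (c2 \<star> q)))))))"
    by (intro sw_cong[OF x] sw_swap_middle rules)
  also have "\<dots> = sw P x (\<lambda>r d. sw P r (\<lambda>a c. sw P a (\<lambda>a1 c1. sw P c (\<lambda>a2 c2.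
      sw P (S d) (\<lambda>p q. \<beta> ((S a1 \<star> c1) \<star> p) ((S a2 \<star> c2) \<star> q))))))"
    by (intro sw_cong[OF x] sw_cong rules) (simp_all add: H.m_assoc antipode_closed)
  also have "\<dots> = sw P x (\<lambda>r d. sw P r (\<lambda>a c. counit H a \<odot>\<^bsub>P\<^esub> sw P c (\<lambda>a2 c2.
      sw P (S d) (\<lambda>p q. \<beta> (\<one>\<^bsub>H\<^esub> \<star> p) ((S a2 \<star> c2) \<star> q)))))"
    by (intro sw_cong[OF x] sw_cong sw_antipode_left rules)
  also have "\<dots> = sw P x (\<lambda>r d. sw P r (\<lambda>a2 c2.
      sw P (S d) (\<lambda>p q. \<beta> (\<one>\<^bsub>H\<^esub> \<star> p) ((S a2 \<star> c2) \<star> q))))"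
    by (intro sw_cong[OF x] sw_counit_left rules)
  also have "\<dots> = sw P x (\<lambda>r d. counit H r \<odot>\<^bsub>P\<^esub>
      sw P (S d) (\<lambda>p q. \<beta> (\<one>\<^bsub>H\<^esub> \<star> p) (\<one>\<^bsub>H\<^esub> \<star> q)))"
    by (intro sw_cong[OF x] sw_antipode_left rules)
  also have "\<dots> = sw P (S x) (\<lambda>p q. \<beta> (\<one>\<^bsub>H\<^esub> \<star> p) (\<one>\<^bsub>H\<^esub> \<star> q))"
    by (intro sw_counit_left rules)
  also have "\<dots> = sw P (S x) \<beta>"
    by (intro sw_cong rules) simp
  finally show ?thesis using E1 by simp
qed

section \<open>The adjoint action\<close>

lemma ad_bilinear: "bilinear K H H H ad"
  unfolding adjoint_def by (intro bilinearI hopf_rules)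

lemmas ad_rules = hopf_rules lin_bilinear_left[OF ad_bilinear] lin_bilinear_right[OF ad_bilinear]
  bilinear_closed[OF ad_bilinear]

text \<open>The antipode reverses products and the comultiplication respects them, so the outer
  factors combine to \<open>S (a \<star> c)\<close> and \<open>b \<star> d\<close>.\<close>

lemma ad_ad:
  assumes g: "g \<in> carrier H" and h: "h \<in> carrier H" and x: "x \<in> carrier H"
  shows "ad h (ad g x) = ad (g \<star> h) x"
proof -
  note rules = bilinearI hopf_rules g h x
  have "ad h (ad g x) = sw H h (\<lambda>c d. sw H g (\<lambda>a b. S c \<star> (S a \<star> x \<star> b) \<star> d))"
    unfolding adjoint_def by (intro sw_cong[OF h] linear_sw[where h = "\<lambda>z. _ \<star> z \<star> _"] rules)
  also have "\<dots> = sw H g (\<lambda>a b. sw H h (\<lambda>c d. S c \<star> (S a \<star> x \<star> b) \<star> d))"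
    by (intro sw_fubini rules)
  also have "\<dots> = sw H g (\<lambda>a b. sw H h (\<lambda>c d. S (a \<star> c) \<star> x \<star> (b \<star> d)))"
    by (intro sw_cong g h) (simp_all add: antipode_mult H.m_assoc antipode_closed x)
  also have "\<dots> = ad (g \<star> h) x"
    unfolding adjoint_def by (intro sw_mult[symmetric] rules)
  finally show ?thesis .
qed

text \<open>Multiplying out the comultiplication of \<open>S s \<star> x \<star> t\<close>, with
  \<open>sw_antipode\<close> for the first factor, leaves only a regrouping of the legs of
  \<open>g\<close>.\<close>

lemma sw_ad:
  assumes P: "module K P" and g: "g \<in> carrier H" and x: "x \<in> carrier H" and b: "bilinear K H H P \<beta>"
  shows "sw P (ad g x) \<beta> = sw P g (\<lambda>a b. sw P x (\<lambda>x1 x2. \<beta> (ad a x1) (ad b x2)))"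
proof -
  note rules = bilinearI ad_rules P g x lin_bilinear_left[OF b] lin_bilinear_right[OF b] bilinear_closed[OF b]
  have "sw P (ad g x) \<beta> = sw P g (\<lambda>s t. sw P (S s \<star> x \<star> t) \<beta>)"
    unfolding adjoint_def by (intro linear_sw[where h = "\<lambda>z. sw P z \<beta>"] rules b)
  also have "\<dots> = sw P g (\<lambda>s t. sw P (S s \<star> x) (\<lambda>y z. sw P t (\<lambda>t1 t2. \<beta> (y \<star> t1) (z \<star> t2))))"
    by (intro sw_cong[OF g] sw_mult b rules)
  also have "\<dots> = sw P g (\<lambda>s t. sw P (S s) (\<lambda>s1 s2. sw P x (\<lambda>x1 x2. sw P t (\<lambda>t1 t2.
      \<beta> (s1 \<star> x1 \<star> t1) (s2 \<star> x2 \<star> t2)))))"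
    by (intro sw_cong[OF g] sw_mult rules)
  also have "\<dots> = sw P g (\<lambda>s t. sw P s (\<lambda>s1 s2. sw P x (\<lambda>x1 x2. sw P t (\<lambda>t1 t2.
      \<beta> (S s1 \<star> x1 \<star> t1) (S s2 \<star> x2 \<star> t2)))))"
    by (intro sw_cong[OF g] sw_antipode rules)
  also have "\<dots> = sw P g (\<lambda>s t. sw P s (\<lambda>s1 s2. sw P t (\<lambda>t1 t2. sw P x (\<lambda>x1 x2.
      \<beta> (S s1 \<star> x1 \<star> t1) (S s2 \<star> x2 \<star> t2)))))"
    by (intro sw_cong[OF g] sw_cong sw_fubini rules)
  \<comment> \<open>Each argument of \<open>\<beta>\<close> must receive both legs of one element;
    cocommutativity achieves this by exchanging \<open>s2\<close> with \<open>t1\<close>.\<close>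
  also have "\<dots> = sw P g (\<lambda>s t. sw P s (\<lambda>s1 t1. sw P t (\<lambda>s2 t2. sw P x (\<lambda>x1 x2.
      \<beta> (S s1 \<star> x1 \<star> t1) (S s2 \<star> x2 \<star> t2)))))"
    by (intro sw_swap_middle rules)
  also have "\<dots> = sw P g (\<lambda>s t. sw P s (\<lambda>s1 t1. sw P x (\<lambda>x1 x2. sw P t (\<lambda>s2 t2.
      \<beta> (S s1 \<star> x1 \<star> t1) (S s2 \<star> x2 \<star> t2)))))"
    by (intro sw_cong[OF g] sw_cong sw_fubini rules)
  also have "\<dots> = sw P g (\<lambda>s t. sw P s (\<lambda>s1 t1. sw P x (\<lambda>x1 x2. \<beta> (S s1 \<star> x1 \<star> t1) (ad t x2))))"
    unfolding adjoint_def
    by (intro sw_cong[OF g] sw_cong sw_cong[OF x] linear_sw[where h = "\<beta> _", symmetric] rules)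
  also have "\<dots> = sw P g (\<lambda>s t. sw P x (\<lambda>x1 x2. sw P s (\<lambda>s1 t1. \<beta> (S s1 \<star> x1 \<star> t1) (ad t x2))))"
    by (intro sw_cong[OF g] sw_fubini rules)
  also have "\<dots> = sw P g (\<lambda>s t. sw P x (\<lambda>x1 x2. \<beta> (ad s x1) (ad t x2)))"
    unfolding adjoint_def[of K H _ _]
    by (intro sw_cong[OF g] sw_cong[OF x] linear_sw[where h = "\<lambda>z. \<beta> z _", symmetric] rules adjoint_def[symmetric])
  finally show ?thesis .
qed

text \<open>The left side is a sum of \<open>g1 S(g2) x g3\<close>, in which the first two factors
  cancel.\<close>

lemma ad_absorb:
  assumes g: "g \<in> carrier H" and x: "x \<in> carrier H"
  shows "sw H g (\<lambda>a b. a \<star> ad b x) = x \<star> g"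
proof -
  note rules = bilinearI hopf_rules g x
  have "sw H g (\<lambda>a b. a \<star> ad b x) = sw H g (\<lambda>a q. sw H q (\<lambda>b c. a \<star> (S b \<star> x \<star> c)))"
    unfolding adjoint_def by (intro sw_cong[OF g] linear_sw rules)
  also have "\<dots> = sw H g (\<lambda>q c. sw H q (\<lambda>a b. a \<star> (S b \<star> x \<star> c)))"
    by (intro coassoc_sw[symmetric] rules)
  also have "\<dots> = sw H g (\<lambda>q c. sw H q (\<lambda>a b. (a \<star> S b) \<star> (x \<star> c)))"
    by (intro sw_cong g) (simp_all add: H.m_assoc antipode_closed x)
  also have "\<dots> = sw H g (\<lambda>q c. counit H q \<odot>\<^bsub>H\<^esub> (\<one>\<^bsub>H\<^esub> \<star> (x \<star> c)))"
    by (intro sw_cong[OF g] sw_antipode_right[where f = "\<lambda>z. z \<star> _"] rules)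
  also have "\<dots> = \<one>\<^bsub>H\<^esub> \<star> (x \<star> g)"
    by (intro sw_counit_left rules)
  finally show ?thesis using g x by simp
qed

text \<open>In \<open>S(g1) x g2 ad(g3)(y)\<close>, where the last factor is the adjoint action of
  \<open>g3\<close> on \<open>y\<close>, \<open>ad_absorb\<close> replaces the end by
  \<open>y\<close> times the remaining leg.\<close>

lemma ad_mult:
  assumes g: "g \<in> carrier H" and x: "x \<in> carrier H" and y: "y \<in> carrier H"
  shows "sw H g (\<lambda>a b. ad a x \<star> ad b y) = ad g (x \<star> y)"
proof -
  note rules = bilinearI ad_rules g x y
  have "sw H g (\<lambda>a b. ad a x \<star> ad b y) = sw H g (\<lambda>a b. sw H a (\<lambda>p q. (S p \<star> x \<star> q) \<star> ad b y))"
    by (subst adjoint_def, intro sw_cong[OF g] linear_sw[where h = "\<lambda>z. z \<star> _"] rules)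
  also have "\<dots> = sw H g (\<lambda>p r. sw H r (\<lambda>q b. (S p \<star> x \<star> q) \<star> ad b y))"
    by (intro coassoc_sw rules)
  also have "\<dots> = sw H g (\<lambda>p r. sw H r (\<lambda>q b. (S p \<star> x) \<star> (q \<star> ad b y)))"
    by (intro sw_cong g) (simp_all add: H.m_assoc antipode_closed bilinear_closed[OF ad_bilinear] x y)
  also have "\<dots> = sw H g (\<lambda>p r. (S p \<star> x) \<star> sw H r (\<lambda>q b. q \<star> ad b y))"
    by (intro sw_cong[OF g] linear_sw[symmetric] rules)
  also have "\<dots> = sw H g (\<lambda>p r. S p \<star> (x \<star> y) \<star> r)"
    by (intro sw_cong g) (simp_all add: ad_absorb H.m_assoc antipode_closed x y)
  finally show ?thesis unfolding adjoint_def .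
qed

end

section \<open>The tensor square of a Hopf algebra\<close>

context cocommutative_hopf_algebra
begin

abbreviation "X \<equiv> tensor_module K H H"
abbreviation "tens x y \<equiv> pure_tensor K H H x y"
abbreviation "comultX \<equiv> tensor_comult K H H"
abbreviation "act \<equiv> tensor_adjoint K H"
abbreviation "nu \<equiv> mult_map K H"

lemma module_X: "module K X"
  by (intro module_tensor module_axioms)

lemmas X_rules = ad_rules module_X

lemma X_ext:
  assumes "module K P" "u \<in> carrier X" "f \<in> linear_maps K X P" "g \<in> linear_maps K X P"
    and "\<And>x y. \<lbrakk>x \<in> carrier H; y \<in> carrier H\<rbrakk> \<Longrightarrow> f (tens x y) = g (tens x y)"
  shows "f u = g u"
  by (rule tensor_ext[OF module_axioms module_axioms assms(1,3,4,5,2)])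

sublocale X: comultiplication K X comultX
proof -
  interpret module K X by (rule module_X)
  have "comultX \<in> linear_maps K X (tensor_module K X X)"
    unfolding tensor_comult_def Let_def
    by (intro tensor_lift_linear module_axioms bilinearI X_rules)
  then show "comultiplication K X comultX"
    by unfold_locales
qed

lemmas XH_rules = bilinearI X_rules X.lin_sw_arg X.lin_sw_body X.sw_closed

text \<open>Reduces Sweedler sums over \<open>X\<close> to double sums over \<open>H\<close>;
  together with \<open>X_ext\<close> it transfers the laws of \<open>H\<close> to
  \<open>X\<close>.\<close>

lemma swX_pure:
  assumes P: "module K P" and x: "x \<in> carrier H" and y: "y \<in> carrier H" and b: "bilinear K X X P \<beta>"
  shows "X.sw P (tens x y) \<beta> = sw P x (\<lambda>x1 x2. sw P y (\<lambda>y1 y2. \<beta> (tens x1 y1) (tens x2 y2)))"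
proof -
  let ?XX = "tensor_module K X X"
  note rules = XH_rules x y P
  have \<Phi>: "tensor_lift K P \<beta> \<in> linear_maps K ?XX P"
    by (intro tensor_lift_linear module_X P b)
  have "X.sw P (tens x y) \<beta> = tensor_lift K P \<beta> (sw ?XX x (\<lambda>x1 x2. sw ?XX y (\<lambda>y1 y2.
      pure_tensor K X X (tens x1 y1) (tens x2 y2))))"
    unfolding tensor_comult_def Let_def
    by (intro arg_cong[of _ _ "tensor_lift K P \<beta>"] tensor_lift_pure rules)
  also have "\<dots> = sw P x (\<lambda>x1 x2. tensor_lift K P \<beta> (sw ?XX y (\<lambda>y1 y2.
      pure_tensor K X X (tens x1 y1) (tens x2 y2))))"
    by (intro linear_sw \<Phi> rules)
  also have "\<dots> = sw P x (\<lambda>x1 x2. sw P y (\<lambda>y1 y2. tensor_lift K P \<beta>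
      (pure_tensor K X X (tens x1 y1) (tens x2 y2))))"
    by (intro sw_cong[OF x] linear_sw \<Phi> rules)
  also have "\<dots> = sw P x (\<lambda>x1 x2. sw P y (\<lambda>y1 y2. \<beta> (tens x1 y1) (tens x2 y2)))"
    by (intro sw_cong[OF x] sw_cong[OF y] tensor_lift_pure b rules)
  finally show ?thesis .
qed

text \<open>On pure tensors, exchanging sums separates the legs of \<open>x\<close> from those of
  \<open>y\<close>; coassociativity of \<open>H\<close> is then used once for each.\<close>

lemma coassoc_X:
  assumes P: "module K P" and u: "u \<in> carrier X"
    and l1: "\<And>v w. \<lbrakk>v \<in> carrier X; w \<in> carrier X\<rbrakk> \<Longrightarrow> (\<lambda>u. \<tau> u v w) \<in> linear_maps K X P"
    and l2: "\<And>u w. \<lbrakk>u \<in> carrier X; w \<in> carrier X\<rbrakk> \<Longrightarrow> (\<lambda>v. \<tau> u v w) \<in> linear_maps K X P"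
    and l3: "\<And>u v. \<lbrakk>u \<in> carrier X; v \<in> carrier X\<rbrakk> \<Longrightarrow> (\<lambda>w. \<tau> u v w) \<in> linear_maps K X P"
  shows "X.sw P u (\<lambda>p c. X.sw P p (\<lambda>a b. \<tau> a b c)) = X.sw P u (\<lambda>a q. X.sw P q (\<lambda>b c. \<tau> a b c))"
proof (rule X_ext[OF P u])
  note \<tau> = linear_maps_comp[OF l1] linear_maps_comp[OF l2] linear_maps_comp[OF l3] linear_maps_closed[OF l1]
  note rules = XH_rules P \<tau>
  show "(\<lambda>u. X.sw P u (\<lambda>p c. X.sw P p (\<lambda>a b. \<tau> a b c))) \<in> linear_maps K X P"
    by (intro rules)
  show "(\<lambda>u. X.sw P u (\<lambda>a q. X.sw P q (\<lambda>b c. \<tau> a b c))) \<in> linear_maps K X P"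
    by (intro rules)
  fix x y assume x: "x \<in> carrier H" and y: "y \<in> carrier H"
  let ?\<tau> = "\<lambda>x1 y1 x2 y2 x3 y3. \<tau> (tens x1 y1) (tens x2 y2) (tens x3 y3)"
  have "X.sw P (tens x y) (\<lambda>p c. X.sw P p (\<lambda>a b. \<tau> a b c))
      = sw P x (\<lambda>p x3. sw P y (\<lambda>q y3. X.sw P (tens p q) (\<lambda>a b. \<tau> a b (tens x3 y3))))"
    by (intro swX_pure rules x y)
  also have "\<dots> = sw P x (\<lambda>p x3. sw P y (\<lambda>q y3. sw P p (\<lambda>x1 x2. sw P q (\<lambda>y1 y2. ?\<tau> x1 y1 x2 y2 x3 y3))))"
    by (intro sw_cong[OF x] sw_cong[OF y] swX_pure rules)
  also have "\<dots> = sw P x (\<lambda>p x3. sw P p (\<lambda>x1 x2. sw P y (\<lambda>q y3. sw P q (\<lambda>y1 y2. ?\<tau> x1 y1 x2 y2 x3 y3))))"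
    by (intro sw_cong[OF x] sw_fubini rules y)
  also have "\<dots> = sw P x (\<lambda>x1 r. sw P r (\<lambda>x2 x3. sw P y (\<lambda>q y3. sw P q (\<lambda>y1 y2. ?\<tau> x1 y1 x2 y2 x3 y3))))"
    by (intro coassoc_sw rules x y)
  also have "\<dots> = sw P x (\<lambda>x1 r. sw P r (\<lambda>x2 x3. sw P y (\<lambda>y1 s. sw P s (\<lambda>y2 y3. ?\<tau> x1 y1 x2 y2 x3 y3))))"
    by (intro sw_cong[OF x] sw_cong coassoc_sw rules y)
  also have "\<dots> = sw P x (\<lambda>x1 r. sw P y (\<lambda>y1 s. sw P r (\<lambda>x2 x3. sw P s (\<lambda>y2 y3. ?\<tau> x1 y1 x2 y2 x3 y3))))"
    by (intro sw_cong[OF x] sw_fubini rules y)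
  also have "\<dots> = sw P x (\<lambda>x1 r. sw P y (\<lambda>y1 s. X.sw P (tens r s) (\<lambda>b c. \<tau> (tens x1 y1) b c)))"
    by (intro sw_cong[OF x] sw_cong[OF y] swX_pure[symmetric] rules)
  also have "\<dots> = X.sw P (tens x y) (\<lambda>a q. X.sw P q (\<lambda>b c. \<tau> a b c))"
    by (intro swX_pure[symmetric] rules x y)
  finally show "X.sw P (tens x y) (\<lambda>p c. X.sw P p (\<lambda>a b. \<tau> a b c))
      = X.sw P (tens x y) (\<lambda>a q. X.sw P q (\<lambda>b c. \<tau> a b c))" .
qed

text \<open>On pure tensors the legs of \<open>y\<close> are flipped first, then those of
  \<open>x\<close>.\<close>

lemma cocomm_X:
  assumes P: "module K P" and u: "u \<in> carrier X" and b: "bilinear K X X P \<beta>"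
  shows "X.sw P u (\<lambda>a b. \<beta> b a) = X.sw P u \<beta>"
proof (rule X_ext[OF P u])
  note rules = XH_rules P b lin_bilinear_left[OF b] lin_bilinear_right[OF b] bilinear_closed[OF b]
  show "(\<lambda>u. X.sw P u (\<lambda>a b. \<beta> b a)) \<in> linear_maps K X P"
    by (intro rules)
  show "(\<lambda>u. X.sw P u \<beta>) \<in> linear_maps K X P"
    by (intro rules)
  fix x y assume x: "x \<in> carrier H" and y: "y \<in> carrier H"
  have "X.sw P (tens x y) (\<lambda>a b. \<beta> b a) = sw P x (\<lambda>x1 x2. sw P y (\<lambda>y1 y2. \<beta> (tens x2 y2) (tens x1 y1)))"
    by (intro swX_pure rules x y)
  also have "\<dots> = sw P x (\<lambda>x1 x2. sw P y (\<lambda>y1 y2. \<beta> (tens x2 y1) (tens x1 y2)))"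
    by (intro sw_cong[OF x] cocomm_sw rules y)
  also have "\<dots> = sw P x (\<lambda>x1 x2. sw P y (\<lambda>y1 y2. \<beta> (tens x1 y1) (tens x2 y2)))"
    by (intro cocomm_sw[where \<beta> = "\<lambda>p q. sw P y (\<lambda>y1 y2. \<beta> (tens p y1) (tens q y2))"] rules x y)
  also have "\<dots> = X.sw P (tens x y) \<beta>"
    by (intro swX_pure[symmetric] rules x y)
  finally show "X.sw P (tens x y) (\<lambda>a b. \<beta> b a) = X.sw P (tens x y) \<beta>" .
qed

section \<open>The map \<open>nu\<close> and the action of \<open>H\<close> on
  \<open>X\<close>\<close>

lemma nu_linear: "nu \<in> linear_maps K X H"
  unfolding mult_map_def by (intro tensor_lift_linear module_axioms mult_bilinear)

lemma nu_pure: "\<lbrakk>x \<in> carrier H; y \<in> carrier H\<rbrakk> \<Longrightarrow> nu (tens x y) = x \<star> y"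
  unfolding mult_map_def by (intro tensor_lift_pure module_axioms mult_bilinear)

lemmas nu_rules = XH_rules linear_maps_comp[OF nu_linear] linear_maps_closed[OF nu_linear]

text \<open>Says that \<open>nu\<close> is compatible with comultiplication; on pure tensors this is
  multiplicativity of the comultiplication of \<open>H\<close>.\<close>

lemma sw_nu:
  assumes P: "module K P" and u: "u \<in> carrier X" and b: "bilinear K H H P \<beta>"
  shows "sw P (nu u) \<beta> = X.sw P u (\<lambda>a b. \<beta> (nu a) (nu b))"
proof (rule X_ext[OF P u])
  note rules = nu_rules P b lin_bilinear_left[OF b] lin_bilinear_right[OF b] bilinear_closed[OF b]
  show "(\<lambda>u. sw P (nu u) \<beta>) \<in> linear_maps K X P"
    by (intro rules)
  show "(\<lambda>u. X.sw P u (\<lambda>a b. \<beta> (nu a) (nu b))) \<in> linear_maps K X P"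
    by (intro rules)
  fix x y assume x: "x \<in> carrier H" and y: "y \<in> carrier H"
  have "sw P (nu (tens x y)) \<beta> = sw P x (\<lambda>x1 x2. sw P y (\<lambda>y1 y2. \<beta> (x1 \<star> y1) (x2 \<star> y2)))"
    unfolding nu_pure[OF x y] by (intro sw_mult P x y b)
  also have "\<dots> = sw P x (\<lambda>x1 x2. sw P y (\<lambda>y1 y2. \<beta> (nu (tens x1 y1)) (nu (tens x2 y2))))"
    by (intro sw_cong x y) (simp add: nu_pure)
  also have "\<dots> = X.sw P (tens x y) (\<lambda>a b. \<beta> (nu a) (nu b))"
    by (intro swX_pure[symmetric] rules x y)
  finally show "sw P (nu (tens x y)) \<beta> = X.sw P (tens x y) (\<lambda>a b. \<beta> (nu a) (nu b))" .
qed

lemma act_bilinear: "bilinear K X H X act"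
  unfolding tensor_adjoint_def Let_def
  by (intro bilinearI tensor_lift_linear lin_lift_body[OF module_axioms module_axioms] X_rules)

lemma act_pure:
  assumes "x \<in> carrier H" "y \<in> carrier H" "g \<in> carrier H"
  shows "act (tens x y) g = sw X g (\<lambda>g1 g2. tens (ad g1 x) (ad g2 y))"
  unfolding tensor_adjoint_def Let_def by (intro tensor_lift_pure XH_rules assms)

lemmas act_rules = nu_rules lin_bilinear_left[OF act_bilinear] lin_bilinear_right[OF act_bilinear]
  bilinear_closed[OF act_bilinear]

text \<open>On pure tensors \<open>ad_ad\<close> applies in both factors, and \<open>sw_mult\<close>
  matches products of legs with the legs of \<open>g \<star> h\<close>.\<close>

lemma act_act:
  assumes u: "u \<in> carrier X" and g: "g \<in> carrier H" and h: "h \<in> carrier H"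
  shows "act (act u g) h = act u (g \<star> h)"
proof (rule X_ext[OF module_X u])
  note rules = act_rules g h
  show "(\<lambda>u. act (act u g) h) \<in> linear_maps K X X"
    by (intro rules)
  show "(\<lambda>u. act u (g \<star> h)) \<in> linear_maps K X X"
    by (intro rules)
  fix x y assume x: "x \<in> carrier H" and y: "y \<in> carrier H"
  have "act (act (tens x y) g) h = sw X g (\<lambda>g1 g2. act (tens (ad g1 x) (ad g2 y)) h)"
    unfolding act_pure[OF x y g] by (intro linear_sw[where h = "\<lambda>u. act u h"] rules x y)
  also have "\<dots> = sw X g (\<lambda>g1 g2. sw X h (\<lambda>h1 h2. tens (ad h1 (ad g1 x)) (ad h2 (ad g2 y))))"
    by (intro sw_cong[OF g] act_pure rules x y)
  also have "\<dots> = sw X g (\<lambda>g1 g2. sw X h (\<lambda>h1 h2. tens (ad (g1 \<star> h1) x) (ad (g2 \<star> h2) y)))"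
    by (intro sw_cong g h) (simp add: ad_ad x y)
  also have "\<dots> = sw X (g \<star> h) (\<lambda>a b. tens (ad a x) (ad b y))"
    by (intro sw_mult[symmetric] rules x y)
  also have "\<dots> = act (tens x y) (g \<star> h)"
    using x y g h by (simp add: act_pure)
  finally show "act (act (tens x y) g) h = act (tens x y) (g \<star> h)" .
qed

text \<open>Equivariance of \<open>nu\<close>; on pure tensors it is \<open>ad_mult\<close>.\<close>

lemma nu_act:
  assumes u: "u \<in> carrier X" and g: "g \<in> carrier H"
  shows "nu (act u g) = ad g (nu u)"
proof (rule X_ext[OF module_axioms u])
  note rules = act_rules g
  show "(\<lambda>u. nu (act u g)) \<in> linear_maps K X H"
    by (intro rules)
  show "(\<lambda>u. ad g (nu u)) \<in> linear_maps K X H"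
    by (intro rules)
  fix x y assume x: "x \<in> carrier H" and y: "y \<in> carrier H"
  have "nu (act (tens x y) g) = sw H g (\<lambda>g1 g2. nu (tens (ad g1 x) (ad g2 y)))"
    unfolding act_pure[OF x y g] by (intro linear_sw nu_linear rules x y)
  also have "\<dots> = sw H g (\<lambda>g1 g2. ad g1 x \<star> ad g2 y)"
    by (intro sw_cong[OF g] nu_pure rules x y)
  also have "\<dots> = ad g (nu (tens x y))"
    by (simp add: ad_mult nu_pure x y g)
  finally show "nu (act (tens x y) g) = ad g (nu (tens x y))" .
qed

text \<open>On pure tensors both sides are brought to one normal form, with the legs of
  \<open>g\<close> summed outermost and those of \<open>x\<close> and \<open>y\<close>
  inside.\<close>

lemma swX_act:
  assumes P: "module K P" and u: "u \<in> carrier X" and g: "g \<in> carrier H" and b: "bilinear K X X P \<beta>"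
  shows "X.sw P (act u g) \<beta> = X.sw P u (\<lambda>u1 u2. sw P g (\<lambda>g1 g2. \<beta> (act u1 g1) (act u2 g2)))"
proof (rule X_ext[OF P u])
  note rules = act_rules g P b lin_bilinear_left[OF b] lin_bilinear_right[OF b] bilinear_closed[OF b]
  show "(\<lambda>u. X.sw P (act u g) \<beta>) \<in> linear_maps K X P"
    by (intro rules)
  show "(\<lambda>u. X.sw P u (\<lambda>u1 u2. sw P g (\<lambda>g1 g2. \<beta> (act u1 g1) (act u2 g2)))) \<in> linear_maps K X P"
    by (intro rules)
  fix x y assume x: "x \<in> carrier H" and y: "y \<in> carrier H"
  note rules = rules x y
  let ?\<beta> = "\<lambda>a1 b1 a2 b2 x1 x2 y1 y2. \<beta> (tens (ad a1 x1) (ad b1 y1)) (tens (ad a2 x2) (ad b2 y2))"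
  have "X.sw P (act (tens x y) g) \<beta> = sw P g (\<lambda>a b. X.sw P (tens (ad a x) (ad b y)) \<beta>)"
    unfolding act_pure[OF x y g] by (intro linear_sw[where h = "\<lambda>u. X.sw P u \<beta>"] rules)
  also have "\<dots> = sw P g (\<lambda>a b. sw P (ad a x) (\<lambda>x1 x2. sw P (ad b y) (\<lambda>y1 y2. \<beta> (tens x1 y1) (tens x2 y2))))"
    by (intro sw_cong[OF g] swX_pure rules)
  also have "\<dots> = sw P g (\<lambda>a b. sw P a (\<lambda>a1 a2. sw P x (\<lambda>x1 x2.
      sw P (ad b y) (\<lambda>y1 y2. \<beta> (tens (ad a1 x1) y1) (tens (ad a2 x2) y2)))))"
    by (intro sw_cong[OF g] sw_ad rules)
  also have "\<dots> = sw P g (\<lambda>a b. sw P a (\<lambda>a1 a2. sw P x (\<lambda>x1 x2. sw P b (\<lambda>b1 b2. sw P y (\<lambda>y1 y2.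
      ?\<beta> a1 b1 a2 b2 x1 x2 y1 y2)))))"
    by (intro sw_cong[OF g] sw_cong sw_cong[OF x] sw_ad rules)
  also have "\<dots> = sw P g (\<lambda>a b. sw P a (\<lambda>a1 a2. sw P b (\<lambda>b1 b2. sw P x (\<lambda>x1 x2. sw P y (\<lambda>y1 y2.
      ?\<beta> a1 b1 a2 b2 x1 x2 y1 y2)))))"
    by (intro sw_cong[OF g] sw_cong sw_fubini rules)
  \<comment> \<open>So far \<open>a1\<close>, \<open>a2\<close> act on the legs of \<open>x\<close>
    and \<open>b1\<close>, \<open>b2\<close> on those of \<open>y\<close>; the exchange pairs the
    legs by factor of \<open>X \<otimes> X\<close> instead.\<close>
  also have "\<dots> = sw P g (\<lambda>g1 g2. sw P g1 (\<lambda>a1 b1. sw P g2 (\<lambda>a2 b2. sw P x (\<lambda>x1 x2. sw P y (\<lambda>y1 y2.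
      ?\<beta> a1 b1 a2 b2 x1 x2 y1 y2)))))"
    by (intro sw_swap_middle rules)
  finally have lhs: "X.sw P (act (tens x y) g) \<beta> = \<dots>" .
  have "X.sw P (tens x y) (\<lambda>u1 u2. sw P g (\<lambda>g1 g2. \<beta> (act u1 g1) (act u2 g2)))
      = sw P x (\<lambda>x1 x2. sw P y (\<lambda>y1 y2. sw P g (\<lambda>g1 g2. \<beta> (act (tens x1 y1) g1) (act (tens x2 y2) g2))))"
    by (intro swX_pure rules)
  also have "\<dots> = sw P x (\<lambda>x1 x2. sw P g (\<lambda>g1 g2. sw P y (\<lambda>y1 y2. \<beta> (act (tens x1 y1) g1) (act (tens x2 y2) g2))))"
    by (intro sw_cong[OF x] sw_fubini rules)
  also have "\<dots> = sw P g (\<lambda>g1 g2. sw P x (\<lambda>x1 x2. sw P y (\<lambda>y1 y2. \<beta> (act (tens x1 y1) g1) (act (tens x2 y2) g2))))"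
    by (intro sw_fubini rules)
  also have "\<dots> = sw P g (\<lambda>g1 g2. sw P x (\<lambda>x1 x2. sw P y (\<lambda>y1 y2. sw P g1 (\<lambda>a1 b1. sw P g2 (\<lambda>a2 b2.
      ?\<beta> a1 b1 a2 b2 x1 x2 y1 y2)))))"
  proof (intro sw_cong x y g)
    fix g1 g2 x1 x2 y1 y2
    assume in_H: "g1 \<in> carrier H" "g2 \<in> carrier H" "x1 \<in> carrier H" "x2 \<in> carrier H" "y1 \<in> carrier H" "y2 \<in> carrier H"
    have "\<beta> (act (tens x1 y1) g1) (act (tens x2 y2) g2)
        = sw P g1 (\<lambda>a1 b1. \<beta> (tens (ad a1 x1) (ad b1 y1)) (act (tens x2 y2) g2))"
      unfolding act_pure[OF in_H(3,5,1)]
      by (intro linear_sw[where h = "\<lambda>z. \<beta> z _"] rules in_H)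
    also have "\<dots> = sw P g1 (\<lambda>a1 b1. sw P g2 (\<lambda>a2 b2. ?\<beta> a1 b1 a2 b2 x1 x2 y1 y2))"
      unfolding act_pure[OF in_H(4,6,2)]
      by (intro sw_cong[OF in_H(1)] linear_sw[where h = "\<beta> _"] rules in_H)
    finally show "\<beta> (act (tens x1 y1) g1) (act (tens x2 y2) g2)
        = sw P g1 (\<lambda>a1 b1. sw P g2 (\<lambda>a2 b2. ?\<beta> a1 b1 a2 b2 x1 x2 y1 y2))" .
  qed
  \<comment> \<open>From here on the order of summation is all that changes.\<close>
  also have "\<dots> = sw P g (\<lambda>g1 g2. sw P x (\<lambda>x1 x2. sw P g1 (\<lambda>a1 b1. sw P y (\<lambda>y1 y2. sw P g2 (\<lambda>a2 b2.
      ?\<beta> a1 b1 a2 b2 x1 x2 y1 y2)))))"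
    by (intro sw_cong[OF g] sw_cong[OF x] sw_fubini rules)
  also have "\<dots> = sw P g (\<lambda>g1 g2. sw P g1 (\<lambda>a1 b1. sw P x (\<lambda>x1 x2. sw P y (\<lambda>y1 y2. sw P g2 (\<lambda>a2 b2.
      ?\<beta> a1 b1 a2 b2 x1 x2 y1 y2)))))"
    by (intro sw_cong[OF g] sw_fubini rules)
  also have "\<dots> = sw P g (\<lambda>g1 g2. sw P g1 (\<lambda>a1 b1. sw P x (\<lambda>x1 x2. sw P g2 (\<lambda>a2 b2. sw P y (\<lambda>y1 y2.
      ?\<beta> a1 b1 a2 b2 x1 x2 y1 y2)))))"
    by (intro sw_cong[OF g] sw_cong sw_cong[OF x] sw_fubini rules)
  also have "\<dots> = sw P g (\<lambda>g1 g2. sw P g1 (\<lambda>a1 b1. sw P g2 (\<lambda>a2 b2. sw P x (\<lambda>x1 x2. sw P y (\<lambda>y1 y2.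
      ?\<beta> a1 b1 a2 b2 x1 x2 y1 y2)))))"
    by (intro sw_cong[OF g] sw_cong sw_fubini rules)
  finally show "X.sw P (act (tens x y) g) \<beta>
      = X.sw P (tens x y) (\<lambda>u1 u2. sw P g (\<lambda>g1 g2. \<beta> (act u1 g1) (act u2 g2)))"
    unfolding lhs ..
qed

sublocale X: linear_rack K X comultX "\<lambda>u v. act u (nu v)"
proof unfold_locales
  let ?XX = "tensor_module K X X"
  let ?T = "tensor_module K X ?XX"
  fix u assume u: "u \<in> carrier X"
  show "X.sw ?T u (\<lambda>a b. X.sw ?T a (\<lambda>c d. pure_tensor K X ?XX c (pure_tensor K X X d b)))
      = X.sw ?T u (\<lambda>a b. X.sw ?T b (\<lambda>c d. pure_tensor K X ?XX a (pure_tensor K X X c d)))"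
    by (intro coassoc_X u XH_rules)
  have "X.sw ?XX u (\<lambda>a b. pure_tensor K X X b a) = X.sw ?XX u (pure_tensor K X X)"
    by (intro cocomm_X u XH_rules bilinear_pure)
  then show "X.sw ?XX u (\<lambda>a b. pure_tensor K X X b a) = comultX u"
    by (simp add: lift_pure_tensor module_X X.comult_closed u)
next
  show "bilinear K X X X (\<lambda>u v. act u (nu v))"
    by (intro act_rules)
next
  let ?XX = "tensor_module K X X"
  fix u v assume u: "u \<in> carrier X" and v: "v \<in> carrier X"
  have "comultX (act u (nu v)) = X.sw ?XX (act u (nu v)) (pure_tensor K X X)"
    by (intro lift_pure_tensor[symmetric] module_X X.comult_closed act_rules u v)
  also have "\<dots> = X.sw ?XX u (\<lambda>u1 u2. sw ?XX (nu v) (\<lambda>g1 g2. pure_tensor K X X (act u1 g1) (act u2 g2)))"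
    by (intro swX_act act_rules bilinear_pure u v)
  also have "\<dots> = X.sw ?XX u (\<lambda>u1 u2. X.sw ?XX v (\<lambda>v1 v2.
      pure_tensor K X X (act u1 (nu v1)) (act u2 (nu v2))))"
    by (intro X.sw_cong[OF u] sw_nu act_rules v)
  finally show "comultX (act u (nu v)) = \<dots>" .
next
  fix u v w assume u: "u \<in> carrier X" and v: "v \<in> carrier X" and w: "w \<in> carrier X"
  note rules = act_rules u v w
  \<comment> \<open>Equivariance turns the second acting element into
    \<open>ad (nu w2) (nu v)\<close>, and \<open>act_act\<close> merges the two actions.\<close>
  have "X.sw X w (\<lambda>w1 w2. act (act u (nu w1)) (nu (act v (nu w2))))
      = X.sw X w (\<lambda>w1 w2. act u (nu w1 \<star> ad (nu w2) (nu v)))"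
    by (intro X.sw_cong[OF w]) (simp add: nu_act act_act linear_maps_closed[OF nu_linear]
        bilinear_closed[OF ad_bilinear] u v)
  also have "\<dots> = act u (X.sw H w (\<lambda>w1 w2. nu w1 \<star> ad (nu w2) (nu v)))"
    by (intro X.linear_sw[symmetric] rules)
  \<comment> \<open>Since \<open>nu\<close> respects comultiplication, the legs of \<open>w\<close>
    become the legs of \<open>nu w\<close>, to which \<open>ad_absorb\<close> applies.\<close>
  also have "X.sw H w (\<lambda>w1 w2. nu w1 \<star> ad (nu w2) (nu v)) = sw H (nu w) (\<lambda>a b. a \<star> ad b (nu v))"
    by (intro sw_nu[symmetric] rules)
  also have "\<dots> = nu v \<star> nu w"
    by (intro ad_absorb rules)
  also have "act u \<dots> = act (act u (nu v)) (nu w)"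
    by (intro act_act[symmetric] rules)
  finally show "X.sw X w (\<lambda>w1 w2. act (act u (nu w1)) (nu (act v (nu w2)))) = act (act u (nu v)) (nu w)" .
qed

end

theorem proposition5p3:
  fixes K :: "('k, 'r) ring_scheme" and H :: "('k, 'h, 'm) hopf_algebra_scheme"
  defines "X \<equiv> tensor_module K H H"
  assumes "cocommutative_hopf_algebra K H"
  shows "yang_baxter_solution K X
    (r_matrix K X (tensor_comult K H H) (tensor_adjoint K H) (mult_map K H))"
proof -
  interpret cocommutative_hopf_algebra K H by fact
  \<comment> \<open>With \<open>u \<triangleleft> v\<close> read as \<open>act u (nu v)\<close>, the
    operator of \<open>X.yang_baxter\<close> is literally the unfolded
    \<open>r_matrix\<close>.\<close>
  show ?thesis
    using X.yang_baxter unfolding X_def r_matrix_def Let_def .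
qed

end
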